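(* Let $G$ and $H$ be connected graphs on at least three vertices each, and let $F$ be a field of characteristic zero or larger than $2^{|V(G)||V(H)|}$. Then $\ell(J_{G,H})<|E(G)||E(H)|$ in each of the following cases: (1) $G$ contains a star of larger order than some cycle in $H$; (2) both $G$ and $H$ contain a cycle, and at least one of these cycles is even; (3) one of $G$ or $H$ contains a cycle, and the other contains a cycle with a leaf.
   Context: Graphs are finite and simple; "contains" means contains as a (not necessarily induced) subgraph. The order of a graph is its number of vertices. The star of order $n\ge2$ is the graph on $[n]$ with edges $\{1,i\}$, $2\le i\le n$. A cycle of order $k\ge 3$ is the graph $C_k$ on $[k]$ with edges $\{1,2\},\dots,\{k-1,k\},\{1,k\}$; it is even if $k$ is even. A cycle with a leaf is a graph obtained from a cycle by adding one new vertex $v$ and one new edge joining $v$ to a vertex of the cycle. Binomial edge ideal of a pair: for graphs $G$ on $[n]$ and $H$ on $[m]$, in $S=F[x_{i,j}\mid 1\le i\le n,1\le j\le m]$ let $J_{G,H}$ be the ideal generated by the binomials $x_{i,k}x_{j,l}-x_{i,l}x_{j,k}$ for all $\{i,j\}\in E(G)$, $i<j$, and $\{k,l\}\in E(H)$, $k<l$. Analytic spread: for an ideal $I\subset S$ with graded maximal ideal $\mathfrak m=(x_{i,j})$, $\ell(I)$ is the Krull dimension of the special fiber ring $\bigoplus_{k\ge0} I^k/\mathfrak m I^k$. *)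

theory Defs
  imports
    "HOL-Library.Poly_Mapping"
    "HOL-Library.Extended_Nat"
    "HOL-Algebra.QuotRing"
    "HOL-Algebra.Ideal_Product"
    "HOL-Algebra.UnivPoly"
    "HOL-Algebra.Subrings"
begin

section \<open>Finite simple graphs\<close>

record 'v sgraph =
  verts :: "'v set"
  edges :: "'v set set"

definition simple_graph :: "'v sgraph \<Rightarrow> bool" where
  "simple_graph G \<longleftrightarrow> finite (verts G) \<and> (\<forall>e\<in>edges G. e \<subseteq> verts G \<and> card e = 2)"

definition connected_graph :: "'v sgraph \<Rightarrow> bool" where
  "connected_graph G \<longleftrightarrow> verts G \<noteq> {} \<and>
     (\<forall>u\<in>verts G. \<forall>v\<in>verts G. (u, v) \<in> {(a, b). {a, b} \<in> edges G}\<^sup>*)"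

text \<open>Subgraphs need not be induced, and they are taken up to isomorphism.\<close>

definition contains_graph :: "'v sgraph \<Rightarrow> 'w sgraph \<Rightarrow> bool" where
  "contains_graph G H \<longleftrightarrow>
     (\<exists>f. inj_on f (verts H) \<and> f ` verts H \<subseteq> verts G \<and> (\<forall>e\<in>edges H. f ` e \<in> edges G))"

definition star_graph :: "nat \<Rightarrow> nat sgraph" where
  "star_graph n = \<lparr>verts = {1..n}, edges = {{1, i} | i. 2 \<le> i \<and> i \<le> n}\<rparr>"

definition cycle_graph :: "nat \<Rightarrow> nat sgraph" where
  "cycle_graph k = \<lparr>verts = {1..k}, edges = insert {1, k} {{i, i + 1} | i. 1 \<le> i \<and> i < k}\<rparr>"

definition is_cycle_with_leaf :: "nat sgraph \<Rightarrow> bool" where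
  "is_cycle_with_leaf L \<longleftrightarrow>
     (\<exists>k u v. 3 \<le> k \<and> u \<in> verts (cycle_graph k) \<and> v \<notin> verts (cycle_graph k) \<and>
        L = \<lparr>verts = insert v (verts (cycle_graph k)),
             edges = insert {u, v} (edges (cycle_graph k))\<rparr>)"


section \<open>Polynomial rings\<close>

text \<open>
  A monomial is a finitely supported exponent function \<open>'x \<Rightarrow>\<^sub>0 nat\<close>, and a polynomial is a
  finitely supported coefficient function on monomials. The ring in the variables indexed
  by \<open>X\<close> consists of the polynomials all of whose monomials involve only indices from \<open>X\<close>.
\<close>

definition mpoly_ring :: "'x set \<Rightarrow> (('x \<Rightarrow>\<^sub>0 nat) \<Rightarrow>\<^sub>0 'a::field) ring" where
  "mpoly_ring X =
     \<lparr>carrier = {p. \<forall>t\<in>Poly_Mapping.keys p. Poly_Mapping.keys t \<subseteq> X},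
      mult = (*), one = 1, zero = 0, add = (+)\<rparr>"

lemma cring_mpoly_ring: "cring (mpoly_ring X :: (('x \<Rightarrow>\<^sub>0 nat) \<Rightarrow>\<^sub>0 'a::field) ring)"
proof -
  let ?C = "carrier (mpoly_ring X) :: (('x \<Rightarrow>\<^sub>0 nat) \<Rightarrow>\<^sub>0 'a) set"
  have C: "p \<in> ?C \<longleftrightarrow> (\<forall>t\<in>Poly_Mapping.keys p. Poly_Mapping.keys t \<subseteq> X)" for p
    by (simp add: mpoly_ring_def)
  have add: "p + q \<in> ?C" if "p \<in> ?C" "q \<in> ?C" for p q
    using that Poly_Mapping.keys_add[of p q] by (auto simp: C)
  have mult: "p * q \<in> ?C" if "p \<in> ?C" "q \<in> ?C" for p q
    unfolding C
  proof
    fix t assume "t \<in> Poly_Mapping.keys (p * q)"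
    then obtain u v where "t = u + v" "u \<in> Poly_Mapping.keys p" "v \<in> Poly_Mapping.keys q"
      using keys_mult[of p q] by blast
    then show "Poly_Mapping.keys t \<subseteq> X"
      using that Poly_Mapping.keys_add[of u v] unfolding C by blast
  qed
  have um: "- p \<in> ?C" if "p \<in> ?C" for p
    using that by (auto simp: C)
  have inv: "\<exists>q\<in>?C. q + p = 0" if "p \<in> ?C" for p
    using um[OF that] by (intro bexI[of _ "- p"]) auto
  have ops [simp]: "x \<otimes>\<^bsub>mpoly_ring X\<^esub> y = x * y" "x \<oplus>\<^bsub>mpoly_ring X\<^esub> y = x + y"
    "\<one>\<^bsub>mpoly_ring X\<^esub> = 1" "\<zero>\<^bsub>mpoly_ring X\<^esub> = 0" for x y :: "('x \<Rightarrow>\<^sub>0 nat) \<Rightarrow>\<^sub>0 'a"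
    by (simp_all add: mpoly_ring_def)
  have zero: "0 \<in> ?C" and one: "1 \<in> ?C" by (simp_all add: C)
  show ?thesis
    apply (intro cringI abelian_groupI comm_monoidI; simp only: ops)
             apply (erule (1) add)
            apply (rule zero)
           apply (rule add.assoc)
          apply (rule add.commute)
         apply (rule add_0_left)
        apply (erule inv)
       apply (erule (1) mult)
      apply (rule one)
     apply (rule mult.assoc)
    apply (rule mult_1_left)
   apply (rule mult.commute)
  apply (rule distrib_right)
  done
qed

definition mvar :: "'x \<Rightarrow> (('x \<Rightarrow>\<^sub>0 nat) \<Rightarrow>\<^sub>0 'a::field)" where
  "mvar x = Poly_Mapping.single (Poly_Mapping.single x 1) 1"

definition graded_maximal_ideal :: "'x set \<Rightarrow> (('x \<Rightarrow>\<^sub>0 nat) \<Rightarrow>\<^sub>0 'a::field) set" where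
  "graded_maximal_ideal X = genideal (mpoly_ring X) (mvar ` X)"


section \<open>Analytic spread\<close>

text \<open>The supremum of the lengths of chains of prime ideals; the zero ring gets dimension 0.\<close>

definition krull_dim :: "('a, 'b) ring_scheme \<Rightarrow> enat" where
  "krull_dim R = Sup {enat n | n. \<exists>P. (\<forall>i\<le>n. primeideal (P i) R) \<and> (\<forall>i<n. P i \<subset> P (Suc i))}"

definition ideal_power :: "('a, 'b) ring_scheme \<Rightarrow> 'a set \<Rightarrow> nat \<Rightarrow> 'a set" where
  "ideal_power R I k = I [^]\<^bsub>ideals_set R\<^esub> k"

text \<open>
  The ring \<open>\<Oplus>\<^sub>k I\<^sup>k / M I\<^sup>k\<close>: an element is a sequence whose \<open>k\<close>-th entry is a coset of \<open>M I\<^sup>k\<close>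
  in \<open>I\<^sup>k\<close>, with all but finitely many entries zero (that is, equal to \<open>M I\<^sup>k\<close> itself).
  The product of the classes of \<open>a \<in> I\<^sup>i\<close> and \<open>b \<in> I\<^sup>j\<close> is the class of \<open>a b\<close> modulo \<open>M I\<^sup>i\<^sup>+\<^sup>j\<close>.
\<close>

definition special_fiber_ring ::
    "('a, 'b) ring_scheme \<Rightarrow> 'a set \<Rightarrow> 'a set \<Rightarrow> (nat \<Rightarrow> 'a set) ring" where
  "special_fiber_ring R M I =
     (let J = (\<lambda>k. ideal_prod R M (ideal_power R I k)) in
      \<lparr>carrier = {c. (\<forall>k. \<exists>a\<in>ideal_power R I k. c k = J k +>\<^bsub>R\<^esub> a) \<and> finite {k. c k \<noteq> J k}},
       mult = (\<lambda>c d n. finsum (R Quot J n) (\<lambda>i. rcoset_mult R (J n) (c i) (d (n - i))) {..n}),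
       one = (\<lambda>k. if k = 0 then J 0 +>\<^bsub>R\<^esub> \<one>\<^bsub>R\<^esub> else J k),
       zero = J,
       add = (\<lambda>c d k. set_add R (c k) (d k))\<rparr>)"

lemma ideal_power_simps:
  "ideal_power R I 0 = carrier R"
  "ideal_power R I (Suc k) = ideal_prod R (ideal_power R I k) I"
  by (simp_all add: ideal_power_def ideals_set_def nat_pow_def)

text \<open>The proof maps the Rees algebra, a subring of \<^term>\<open>UP R\<close>, onto the special fiber ring.\<close>

lemma cring_special_fiber_ring:
  fixes R (structure)
  assumes "cring R" "ideal M R" "ideal I R"
  shows "cring (special_fiber_ring R M I)"
proof -
  interpret R: cring R by fact
  have "UP_cring R" by unfold_locales
  then interpret UP: cring "UP R" by (rule UP_cring.UP_cring)
  have UPr: "UP_ring R" by unfold_locales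
  define K where "K = ideal_power R I"
  define J where "J k = ideal_prod R M (K k)" for k
  have K: "ideal (K k) R" for k
    by (induction k) (simp_all add: K_def ideal_power_simps R.oneideal R.ideal_prod_is_ideal assms)
  have J: "ideal (J k) R" for k
    by (simp add: J_def K R.ideal_prod_is_ideal assms)
  have KC: "a \<in> carrier R" if "a \<in> K k" for a k using ideal.Icarr[OF K that] .
  have JC: "a \<in> carrier R" if "a \<in> J k" for a k using ideal.Icarr[OF J that] .
  have JK: "J k \<subseteq> K k" for k
    unfolding J_def using R.ideal_prod_inter[OF assms(2) K] by blast
  have Kadd: "a \<oplus> b \<in> K k" if "a \<in> K k" "b \<in> K k" for a b k
    using that K by (meson additive_subgroup.a_closed ideal.axioms(1))
  have Jadd: "a \<oplus> b \<in> J k" if "a \<in> J k" "b \<in> J k" for a b k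
    using that J by (meson additive_subgroup.a_closed ideal.axioms(1))
  have K0: "\<zero> \<in> K k" for k using K by (meson additive_subgroup.zero_closed ideal.axioms(1))
  have J0: "\<zero> \<in> J k" for k using J by (meson additive_subgroup.zero_closed ideal.axioms(1))
  have Kprod: "ideal_prod R (K i) (K j) = K (i + j)" for i j
  proof (induction j)
    case 0 then show ?case
      using K[of i] by (simp add: K_def ideal_power_simps R.ideal_prod_one)
  next
    case (Suc j)
    have "ideal_prod R (K i) (K (Suc j)) = ideal_prod R (ideal_prod R (K i) (K j)) I"
      using R.ideal_prod_assoc[OF K K assms(3)] by (simp add: K_def ideal_power_simps)
    with Suc show ?case by (simp add: K_def ideal_power_simps)
  qed
  have KK: "a \<otimes> b \<in> K (i + j)" if "a \<in> K i" "b \<in> K j" for a b i j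
    using that Kprod ideal_prod.prod by metis
  have JKprod: "ideal_prod R (J i) (K j) = J (i + j)" for i j
    unfolding J_def using R.ideal_prod_assoc[OF assms(2) K K] Kprod by metis
  have JKm: "a \<otimes> b \<in> J (i + j)" if "a \<in> J i" "b \<in> K j" for a b i j
    using that JKprod ideal_prod.prod by metis
  have KJm: "a \<otimes> b \<in> J (i + j)" if "a \<in> K i" "b \<in> J j" for a b i j
    using JKm[OF that(2,1)] that KC JC by (metis add.commute R.m_comm)
  have coset_eq: "J k +> (z \<oplus> x) = J k +> x" if "z \<in> J k" "x \<in> carrier R" for z x k
  proof -
    interpret Jk: ideal "J k" R by (rule J)
    have "z \<oplus> x \<in> J k +> x" using that by (auto simp: a_r_coset_def r_coset_def)
    then show ?thesis
      using R.a_repr_independence[OF _ that(2) Jk.a_subgroup] by metis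
  qed
  have cm: "rcoset_mult R (J (i + j)) (J i +> a) (J j +> b) = J (i + j) +> (a \<otimes> b)"
    if "a \<in> K i" "b \<in> K j" for a b i j
  proof -
    have *: "J (i + j) +> (a' \<otimes> b') = J (i + j) +> (a \<otimes> b)"
      if a': "a' \<in> J i +> a" and b': "b' \<in> J j +> b" for a' b'
    proof -
      obtain x y where x: "x \<in> J i" "a' = x \<oplus> a" and y: "y \<in> J j" "b' = y \<oplus> b"
        using a' b' by (auto simp: a_r_coset_def r_coset_def)
      note c = KC[OF \<open>a \<in> K i\<close>] KC[OF \<open>b \<in> K j\<close>] JC[OF x(1)] JC[OF y(1)]
      have "a' \<otimes> b' = (x \<otimes> (y \<oplus> b) \<oplus> a \<otimes> y) \<oplus> a \<otimes> b"
        unfolding x y using c by algebra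
      moreover have "x \<otimes> (y \<oplus> b) \<oplus> a \<otimes> y \<in> J (i + j)"
        using x y JK \<open>a \<in> K i\<close> \<open>b \<in> K j\<close> by (blast intro: Jadd JKm KJm Kadd)
      ultimately show ?thesis using coset_eq c by simp
    qed
    have "a \<in> J i +> a" "b \<in> J j +> b"
      using that J0 KC by (auto simp: a_r_coset_def r_coset_def intro!: bexI[of _ \<zero>])
    then show ?thesis unfolding rcoset_mult_def using * by blast
  qed
  define S where "S = {p \<in> carrier (UP R). \<forall>k. p k \<in> K k}"
  have UPc: "carrier (UP R) = up R" by (simp add: UP_def)
  have cf: "coeff (UP R) p k = p k" if "p \<in> carrier (UP R)" for p k
    using that by (simp add: UP_def)
  have addc: "p \<oplus>\<^bsub>UP R\<^esub> q = (\<lambda>i. p i \<oplus> q i)" if "p \<in> S" "q \<in> S" for p q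
    using that by (simp add: S_def UP_def)
  have multc: "p \<otimes>\<^bsub>UP R\<^esub> q = (\<lambda>n. \<Oplus>i\<in>{..n}. p i \<otimes> q (n - i))" if "p \<in> S" "q \<in> S" for p q
    using that by (simp add: S_def UP_def)
  have "subcring S (UP R)"
  proof (rule UP.subcringI')
    show "subring S (UP R)"
    proof (rule UP.subringI)
      show "S \<subseteq> carrier (UP R)" by (auto simp: S_def)
      show "\<one>\<^bsub>UP R\<^esub> \<in> S"
        using K0 UP.one_closed unfolding S_def
        by (simp add: UP_def) (simp add: K_def ideal_power_simps)
    next
      fix p assume p: "p \<in> S"
      then have pc: "p \<in> carrier (UP R)" by (simp add: S_def)
      have mc: "\<ominus>\<^bsub>UP R\<^esub> p \<in> carrier (UP R)" by (rule UP.a_inv_closed[OF pc])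
      have "(\<ominus>\<^bsub>UP R\<^esub> p) k = \<ominus> p k" for k
        using UP_ring.coeff_a_inv[OF UPr pc, of k] pc mc by (simp only: cf)
      then show "\<ominus>\<^bsub>UP R\<^esub> p \<in> S"
        using p mc K unfolding S_def
        by (simp add: additive_subgroup.a_inv_closed ideal.axioms(1))
    next
      fix p q assume p: "p \<in> S" and q: "q \<in> S"
      show "p \<oplus>\<^bsub>UP R\<^esub> q \<in> S"
        using p q UP.a_closed[of p q] Kadd addc[OF p q] by (simp add: S_def)
      have "(\<Oplus>i\<in>{..n}. p i \<otimes> q (n - i)) \<in> K n" for n
      proof -
        have *: "p i \<otimes> q (n - i) \<in> K n" if "i \<in> {..n}" for i
          using KK[of "p i" i "q (n - i)" "n - i"] p q that by (auto simp: S_def)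
        have "A \<subseteq> {..n} \<Longrightarrow> (\<Oplus>i\<in>A. p i \<otimes> q (n - i)) \<in> K n" if "finite A" for A
          using that
        proof (induction A rule: finite_induct)
          case empty then show ?case by (simp add: K0)
        next
          case (insert a A)
          have "(\<lambda>i. p i \<otimes> q (n - i)) \<in> insert a A \<rightarrow> carrier R"
            using insert.prems * KC by blast
          with insert * KC Kadd show ?case by (subst R.finsum_insert) auto
        qed
        then show ?thesis by simp
      qed
      then show "p \<otimes>\<^bsub>UP R\<^esub> q \<in> S"
        using p q UP.m_closed[of p q] multc[OF p q] by (simp add: S_def)
    qed
  qed
  then interpret S: cring "UP R\<lparr>carrier := S\<rparr>"
    using UP.subcring_iff by (auto simp: S_def)
  let ?F = "special_fiber_ring R M I"
  define h where "h p = (\<lambda>k. J k +> p k)" for p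
  have F: "?F = \<lparr>carrier = {c. (\<forall>k. \<exists>a\<in>K k. c k = J k +> a) \<and> finite {k. c k \<noteq> J k}},
       mult = (\<lambda>c d n. finsum (R Quot J n) (\<lambda>i. rcoset_mult R (J n) (c i) (d (n - i))) {..n}),
       one = (\<lambda>k. if k = 0 then J 0 +> \<one> else J k), zero = J,
       add = (\<lambda>c d k. set_add R (c k) (d k))\<rparr>"
    by (simp only: special_fiber_ring_def J_def[abs_def] K_def Let_def)
  have Jz: "J k +> \<zero> = J k" for k
    using J[of k] by (metis R.a_coset_add_zero additive_subgroup.a_subset ideal.axioms(1))
  have Sup: "p \<in> up R" "p k \<in> K k" "p k \<in> carrier R" if "p \<in> S" for p k
    using that KC by (auto simp: S_def UPc)
  have him: "h ` S = carrier ?F"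
  proof
    show "h ` S \<subseteq> carrier ?F"
    proof
      fix c assume "c \<in> h ` S"
      then obtain p where p: "p \<in> S" "c = h p" by blast
      then obtain n where n: "bound \<zero> n p" using Sup(1) by blast
      have "{k. c k \<noteq> J k} \<subseteq> {..n}"
      proof
        fix k assume "k \<in> {k. c k \<noteq> J k}"
        then have "p k \<noteq> \<zero>" using p Jz by (auto simp: h_def)
        with bound_below[OF n] show "k \<in> {..n}" by auto
      qed
      then show "c \<in> carrier ?F" using p Sup(2) by (auto simp: F h_def intro: finite_subset)
    qed
    show "carrier ?F \<subseteq> h ` S"
    proof
      fix c assume "c \<in> carrier ?F"
      then have c: "\<forall>k. \<exists>a\<in>K k. c k = J k +> a" "finite {k. c k \<noteq> J k}" by (auto simp: F)
      then obtain a where a: "\<And>k. a k \<in> K k" "\<And>k. c k = J k +> a k" by metis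
      define p where "p k = (if c k = J k then \<zero> else a k)" for k
      obtain n where n: "\<forall>k\<in>{k. c k \<noteq> J k}. k \<le> n"
        using c(2) finite_nat_set_iff_bounded_le by blast
      have "bound \<zero> n p"
      proof
        fix m assume "n < m"
        then have "c m = J m" using n by (meson leD mem_Collect_eq)
        then show "p m = \<zero>" by (simp add: p_def)
      qed
      moreover have "p k \<in> K k" for k using a K0 by (simp add: p_def)
      ultimately have "p \<in> S" unfolding S_def UPc up_def using KC by blast
      moreover have "h p k = c k" for k
        by (cases "c k = J k") (simp_all add: h_def p_def Jz a(2)[symmetric])
      then have "h p = c" by (rule ext)
      ultimately show "c \<in> h ` S" by (auto intro: rev_image_eqI)
    qed
  qed
  have hom: "h \<in> ring_hom (UP R\<lparr>carrier := S\<rparr>) ?F"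
  proof (rule ring_hom_memI)
    show "h p \<in> carrier ?F" if "p \<in> carrier (UP R\<lparr>carrier := S\<rparr>)" for p
      using that him by auto
    show "h \<one>\<^bsub>UP R\<lparr>carrier := S\<rparr>\<^esub> = \<one>\<^bsub>?F\<^esub>"
      by (rule ext) (simp add: UP_def F h_def Jz)
  next
    fix p q assume "p \<in> carrier (UP R\<lparr>carrier := S\<rparr>)" "q \<in> carrier (UP R\<lparr>carrier := S\<rparr>)"
    then have p: "p \<in> S" and q: "q \<in> S" by auto
    show "h (p \<oplus>\<^bsub>UP R\<lparr>carrier := S\<rparr>\<^esub> q) = h p \<oplus>\<^bsub>?F\<^esub> h q"
    proof
      fix k
      interpret Jk: ideal "J k" R by (rule J)
      show "h (p \<oplus>\<^bsub>UP R\<lparr>carrier := S\<rparr>\<^esub> q) k = (h p \<oplus>\<^bsub>?F\<^esub> h q) k"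
        using Jk.a_rcos_sum[OF Sup(3)[OF p] Sup(3)[OF q]] by (simp add: h_def F addc[OF p q])
    qed
    show "h (p \<otimes>\<^bsub>UP R\<lparr>carrier := S\<rparr>\<^esub> q) = h p \<otimes>\<^bsub>?F\<^esub> h q"
    proof
      fix n
      interpret Jn: ideal "J n" R by (rule J)
      interpret Q: ring_hom_ring R "R Quot J n" "(+>) (J n)" by (rule Jn.rcos_ring_hom_ring)
      have 1: "rcoset_mult R (J n) (J i +> p i) (J (n - i) +> q (n - i))
          = J n +> (p i \<otimes> q (n - i))" if "i \<in> {..n}" for i
      proof -
        have "i + (n - i) = n" using that by simp
        then show ?thesis
          using cm[OF Sup(2)[OF p, of i] Sup(2)[OF q, of "n - i"]] by (simp only:)
      qed
      have 2: "(\<lambda>i. p i \<otimes> q (n - i)) \<in> {..n} \<rightarrow> carrier R"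
        using Sup(3)[OF p] Sup(3)[OF q] by simp
      have "h (p \<otimes>\<^bsub>UP R\<lparr>carrier := S\<rparr>\<^esub> q) n = J n +> (\<Oplus>i\<in>{..n}. p i \<otimes> q (n - i))"
        by (simp add: h_def multc[OF p q])
      also have "\<dots> = finsum (R Quot J n) (\<lambda>i. J n +> (p i \<otimes> q (n - i))) {..n}"
        using Q.hom_finsum[OF 2] by (simp add: comp_def)
      also have "\<dots> = finsum (R Quot J n)
          (\<lambda>i. rcoset_mult R (J n) (J i +> p i) (J (n - i) +> q (n - i))) {..n}"
        using 1 Q.hom_closed 2 by (intro Q.S.finsum_cong') (auto simp: Pi_iff)
      finally show "h (p \<otimes>\<^bsub>UP R\<lparr>carrier := S\<rparr>\<^esub> q) n = (h p \<otimes>\<^bsub>?F\<^esub> h q) n"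
        by (simp add: F h_def)
    qed
  qed
  have hz: "h \<zero>\<^bsub>UP R\<lparr>carrier := S\<rparr>\<^esub> = \<zero>\<^bsub>?F\<^esub>"
    by (rule ext) (simp add: UP_def F h_def Jz)
  have "ring (?F\<lparr>carrier := h ` S, zero := \<zero>\<^bsub>?F\<^esub>\<rparr>)"
    using S.ring_hom_imp_img_ring[OF hom] hz by simp
  then have ring: "ring ?F" by (simp add: him)
  show ?thesis
  proof (rule cring.intro[OF ring], rule comm_monoid.intro)
    show "Group.monoid ?F" using ring by (simp add: ring_def)
    show "comm_monoid_axioms ?F"
    proof
      fix c d assume "c \<in> carrier ?F" "d \<in> carrier ?F"
      then obtain p q where "p \<in> S" "q \<in> S" "c = h p" "d = h q" using him by blast
      then show "c \<otimes>\<^bsub>?F\<^esub> d = d \<otimes>\<^bsub>?F\<^esub> c"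
        using ring_hom_mult[OF hom] S.m_comm by simp metis
    qed
  qed
qed

definition analytic_spread :: "('a, 'b) ring_scheme \<Rightarrow> 'a set \<Rightarrow> 'a set \<Rightarrow> enat" where
  "analytic_spread R M I = krull_dim (special_fiber_ring R M I)"


section \<open>Binomial edge ideal of a pair of graphs\<close>

definition pair_binomial_edge_ideal ::
    "'v::linorder sgraph \<Rightarrow> 'w::linorder sgraph \<Rightarrow> (('v \<times> 'w \<Rightarrow>\<^sub>0 nat) \<Rightarrow>\<^sub>0 'a::field) set" where
  "pair_binomial_edge_ideal G H =
     genideal (mpoly_ring (verts G \<times> verts H))
       {mvar (i, k) * mvar (j, l) - mvar (i, l) * mvar (j, k) | i j k l.
          {i, j} \<in> edges G \<and> i < j \<and> {k, l} \<in> edges H \<and> k < l}"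

end

theory Submission
  imports Defs "HOL-Computational_Algebra.Polynomial"
begin

text \<open>
  The generators of the ideal are forms of degree 2, so the special fiber ring is a quotient of
  the graded algebra they generate. If \<open>Q\<^sub>0 \<subset> \<dots> \<subset> Q\<^sub>n\<close> are primes of this algebra, elements
  \<open>x\<^sub>i \<in> Q\<^sub>i\<^sub>+\<^sub>1 - Q\<^sub>i\<close> have linearly independent monomials, and counting monomials bounds \<open>n\<close> by
  the size of any finite set \<open>Z\<close> of polynomials generating a larger algebra. The bound may be
  computed after an injective monomial substitution, which replaces a localisation at one
  variable. It then suffices to find, for a pair of subgraphs, fewer polynomials generating the
  binomials than there are pairs of edges. For an even cycle or a cycle with a leaf, a
  one-parameter group acting on the variables and fixing the binomials saves one generator. For
  a star and a cycle, the rows of the leaves only matter modulo the row of the centre.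
\<close>

section \<open>Chains of primes and algebraic independence\<close>

text \<open>A cycle has as many edges as vertices. For two cycles the matrix of variables therefore
  has exactly as many entries as there are binomials, and the bound by its entries misses the strict
  inequality by one: each case has to find a saving beyond it. Scaling the rows in opposite ways
  along every edge asks for a bipartition, hence an even cycle. Adding a multiple of one column to
  another fixes the binomials if the second column meets no edge but the one joining the two, hence
  a leaf. A star allows more: every leaf row may be changed by a multiple of the centre row, and the
  saving suffices once there are at least as many leaves as columns. Normalising an entry to 1 means
  dividing by it. Multiplying suitable variables by that entry clears the denominators, and since
  this substitution is injective it preserves algebraic independence. Passing to subgraphs loses
  nothing: a further pair of edges adds one generator and one to the bound aimed at.\<close>

text \<open>
  The smallest power of \<open>x\<^sub>j\<close> can be cancelled modulo \<open>Q\<^sub>j\<close>, and the terms still divisible by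
  \<open>x\<^sub>j\<close> vanish modulo \<open>Q\<^sub>j\<^sub>+\<^sub>1\<close>. This leaves a combination of monomials in the later variables.
\<close>

lemma prime_chain_monomials:
  fixes \<iota> :: "'a::field \<Rightarrow> 'r::comm_ring_1" and x :: "nat \<Rightarrow> 'r"
  assumes \<iota>: "\<And>c d. \<iota> (c * d) = \<iota> c * \<iota> d" "\<iota> 1 = 1"
    and B: "0 \<in> B" "1 \<in> B" "- 1 \<in> B" "\<And>c. \<iota> c \<in> B" "\<And>a b. a \<in> B \<Longrightarrow> b \<in> B \<Longrightarrow> a + b \<in> B"
      "\<And>a b. a \<in> B \<Longrightarrow> b \<in> B \<Longrightarrow> a * b \<in> B"
    and Q: "\<And>i. i \<le> n \<Longrightarrow> Q i \<subseteq> B" "\<And>i. i \<le> n \<Longrightarrow> 1 \<notin> Q i"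
      "\<And>i a b. i \<le> n \<Longrightarrow> a \<in> Q i \<Longrightarrow> b \<in> Q i \<Longrightarrow> a + b \<in> Q i"
      "\<And>i a b. i \<le> n \<Longrightarrow> a \<in> Q i \<Longrightarrow> b \<in> B \<Longrightarrow> a * b \<in> Q i"
      "\<And>i a b. i \<le> n \<Longrightarrow> a \<in> B \<Longrightarrow> b \<in> B \<Longrightarrow> a * b \<in> Q i \<Longrightarrow> a \<in> Q i \<or> b \<in> Q i"
    and mono: "\<And>i. i < n \<Longrightarrow> Q i \<subseteq> Q (Suc i)"
    and x: "\<And>i. i < n \<Longrightarrow> x i \<in> Q (Suc i)" "\<And>i. i < n \<Longrightarrow> x i \<notin> Q i"
  assumes j: "j \<le> n" and E: "finite E" "E \<noteq> {}" "\<And>e. e \<in> E \<Longrightarrow> c e \<noteq> 0"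
    and inj: "\<And>e e'. e \<in> E \<Longrightarrow> e' \<in> E \<Longrightarrow> (\<And>i. i \<in> {j..<n} \<Longrightarrow> e i = e' i) \<Longrightarrow> e = e'"
  shows "(\<Sum>e\<in>E. \<iota> (c e) * (\<Prod>i\<in>{j..<n}. x i ^ e i)) \<notin> Q j"
proof -
  have xB: "x i \<in> B" if "i < n" for i using x(1)[OF that] Q(1)[of "Suc i"] that by auto
  have powB: "a ^ k \<in> B" if "a \<in> B" for a k using that by (induction k) (auto intro: B(1,2,5,6))
  have prodB: "(\<Prod>i\<in>I. g i) \<in> B" if "\<And>i. i \<in> I \<Longrightarrow> g i \<in> B" for g and I :: "nat set"
    using that by (induction I rule: infinite_finite_induct) (auto intro: B(1,2,5,6))
  have sumB: "(\<Sum>e\<in>I. g e) \<in> B" if "\<And>e. e \<in> I \<Longrightarrow> g e \<in> B" for g and I :: "(nat \<Rightarrow> nat) set"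
    using that by (induction I rule: infinite_finite_induct) (auto intro: B(1,2,5,6))
  show ?thesis
    using j E inj
  proof (induction j arbitrary: E rule: inc_induct)
    \<comment> \<open>At \<open>j = n\<close> no variable is left, so \<open>inj\<close> makes
      \<open>E\<close> a singleton; the sum is a nonzero constant, a unit, and cannot lie in the
      proper ideal \<open>Q n\<close>.\<close>
    case base
    from base(2) obtain e where "e \<in> E" by blast
    moreover have "e' = e" if "e' \<in> E" for e' by (rule base(4)[OF that \<open>e \<in> E\<close>]) simp
    ultimately have e: "E = {e}" by blast
    then have "\<iota> (c e) * \<iota> (inverse (c e)) = 1"
      using base(3)[OF \<open>e \<in> E\<close>] by (simp add: \<iota>(2) flip: \<iota>(1))
    then show ?case using e Q(2)[of n] Q(4)[of n "\<iota> (c e)" "\<iota> (inverse (c e))"] B(4) by auto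
  next
    case (step j)
    define m where "m = Min ((\<lambda>e. e j) ` E)"
    define D where "D = {e\<in>E. e j = m}"
    let ?t = "\<lambda>e. \<iota> (c e) * (\<Prod>i\<in>{Suc j..<n}. x i ^ e i)"
    define s1 where "s1 = (\<Sum>e\<in>D. ?t e)"
    define s2 where "s2 = (\<Sum>e\<in>E - D. ?t e * x j ^ (e j - m - 1))"
    have m: "m \<in> (\<lambda>e. e j) ` E" "\<And>e. e \<in> E \<Longrightarrow> m \<le> e j"
      unfolding m_def using step.prems(1,2) by auto
    have DE: "D \<subseteq> E" "finite D" "D \<noteq> {}" using m step.prems(1) by (auto simp: D_def)
    have "s1 \<notin> Q (Suc j)"
      unfolding s1_def
    proof (rule step.IH)
      fix e e' assume "e \<in> D" "e' \<in> D" and eq: "\<And>i. i \<in> {Suc j..<n} \<Longrightarrow> e i = e' i"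
      have "e i = e' i" if "i \<in> {j..<n}" for i
        using eq[of i] that \<open>e \<in> D\<close> \<open>e' \<in> D\<close> by (cases "i = j") (auto simp: D_def)
      then show "e = e'" using \<open>e \<in> D\<close> \<open>e' \<in> D\<close> DE(1) by (intro step.prems(4)) auto
    next
      show "c e \<noteq> 0" if "e \<in> D" for e using that DE(1) step.prems(3) by blast
    qed (rule DE)+
    have tB: "?t e \<in> B" for e by (rule B(6), rule B(4), rule prodB, rule powB, rule xB) simp
    have s2B: "s2 \<in> B" unfolding s2_def by (rule sumB, rule B(6), rule tB, rule powB, rule xB, rule step.hyps)
    have s1B: "s1 \<in> B" unfolding s1_def by (intro sumB tB)
    have split: "{j..<n} = insert j {Suc j..<n}" using step.hyps by auto
    have "(\<Sum>e\<in>E. \<iota> (c e) * (\<Prod>i\<in>{j..<n}. x i ^ e i)) = (\<Sum>e\<in>E. ?t e * x j ^ e j)"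
      unfolding split by (simp add: mult_ac)
    also have "\<dots> = (\<Sum>e\<in>D. ?t e * x j ^ e j) + (\<Sum>e\<in>E - D. ?t e * x j ^ e j)"
      by (subst sum.subset_diff[OF DE(1) step.prems(1)]) (rule add.commute)
    also have "(\<Sum>e\<in>D. ?t e * x j ^ e j) = x j ^ m * s1"
      unfolding s1_def sum_distrib_left by (rule sum.cong) (auto simp: D_def mult_ac)
    also have "(\<Sum>e\<in>E - D. ?t e * x j ^ e j) = x j ^ m * (x j * s2)"
      unfolding s2_def sum_distrib_left
    proof (rule sum.cong)
      fix e assume "e \<in> E - D"
      then have "m < e j" using m(2)[of e] by (auto simp: D_def)
      then have "e j = m + Suc (e j - m - 1)" by simp
      then have "x j ^ e j = x j ^ m * (x j * x j ^ (e j - m - 1))"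
        by (metis power_add power_Suc)
      then show "?t e * x j ^ e j = x j ^ m * (x j * (?t e * x j ^ (e j - m - 1)))"
        by (simp add: mult_ac)
    qed simp
    finally have eq: "(\<Sum>e\<in>E. \<iota> (c e) * (\<Prod>i\<in>{j..<n}. x i ^ e i)) = x j ^ m * (s1 + x j * s2)"
      by (simp add: distrib_left)
    have pow: "x j ^ k \<notin> Q j" for k
    proof (induction k)
      case 0 show ?case using Q(2)[of j] step.hyps by simp
    next
      case (Suc k)
      then show ?case
        using Q(5)[of j "x j" "x j ^ k"] x(2)[of j] xB[of j] powB[of "x j" k] step.hyps by auto
    qed
    show ?case
    proof
      assume "(\<Sum>e\<in>E. \<iota> (c e) * (\<Prod>i\<in>{j..<n}. x i ^ e i)) \<in> Q j"
      then have "x j ^ m \<in> Q j \<or> s1 + x j * s2 \<in> Q j"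
        unfolding eq using step.hyps
        by (intro Q(5) powB B(5) B(6)[OF _ s2B] xB s1B) auto
      then have 1: "s1 + x j * s2 \<in> Q (Suc j)" using pow[of m] mono[of j] step.hyps by blast
      \<comment> \<open>The sets \<open>Q i\<close> are only assumed closed under sums and
        multiples, so the subtraction of \<open>x j * s2\<close> goes through
        \<open>- 1 \<in> B\<close>.\<close>
      have 2: "x j * (s2 * - 1) \<in> Q (Suc j)"
        using step.hyps by (intro Q(4) x(1) B(6) B(3) s2B) auto
      have "s1 = (s1 + x j * s2) + x j * (s2 * - 1)" by simp
      then have "s1 \<in> Q (Suc j)" using Q(3)[OF _ 1 2] step.hyps by simp
      with \<open>s1 \<notin> Q (Suc j)\<close> show False ..
    qed
  qed
qed

section \<open>Dimension counts in finitely generated algebras\<close>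

abbreviation cst :: "'a::zero \<Rightarrow> ('x \<Rightarrow>\<^sub>0 nat) \<Rightarrow>\<^sub>0 'a" where
  "cst c \<equiv> Poly_Mapping.single 0 c"

interpretation mpoly: vector_space "\<lambda>c p. cst c * p :: ('x \<Rightarrow>\<^sub>0 nat) \<Rightarrow>\<^sub>0 'a::field"
  by unfold_locales (simp_all add: algebra_simps single_add mult_single)

inductive alg :: "(('x \<Rightarrow>\<^sub>0 nat) \<Rightarrow>\<^sub>0 'a::field) set \<Rightarrow> (('x \<Rightarrow>\<^sub>0 nat) \<Rightarrow>\<^sub>0 'a) \<Rightarrow> bool" for Z where
  const: "alg Z (cst c)"
| gen: "z \<in> Z \<Longrightarrow> alg Z z"
| add: "alg Z p \<Longrightarrow> alg Z q \<Longrightarrow> alg Z (p + q)"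
| mult: "alg Z p \<Longrightarrow> alg Z q \<Longrightarrow> alg Z (p * q)"

text \<open>Bounding each exponent separately instead of the total degree makes the count of
  spanning monomials immediate: at most \<open>(d + 1) ^ card Z\<close> for finite
  \<open>Z\<close>.\<close>

definition box_span :: "(('x \<Rightarrow>\<^sub>0 nat) \<Rightarrow>\<^sub>0 'a::field) set \<Rightarrow> nat \<Rightarrow> (('x \<Rightarrow>\<^sub>0 nat) \<Rightarrow>\<^sub>0 'a) set" where
  "box_span Z d = mpoly.span ((\<lambda>a. \<Prod>z\<in>Z. z ^ a z) ` (Z \<rightarrow>\<^sub>E {..d}))"

lemma box_span_memI: "(\<And>z. z \<in> Z \<Longrightarrow> a z \<le> d) \<Longrightarrow> (\<Prod>z\<in>Z. z ^ a z) \<in> box_span Z d"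
  unfolding box_span_def
  by (rule mpoly.span_base, rule image_eqI[of _ _ "restrict a Z"]) (auto intro!: prod.cong)

lemma box_span_mono:
  assumes "d \<le> d'"
  shows "box_span Z d \<subseteq> box_span Z d'"
  unfolding box_span_def using assms
  by (intro mpoly.span_mono image_mono PiE_mono) auto

lemma box_span_mult:
  assumes "p \<in> box_span Z d" "q \<in> box_span Z d'"
  shows "p * q \<in> box_span Z (d + d')"
  using assms(1) unfolding box_span_def[of Z d]
proof (induction rule: mpoly.span_induct_alt)
  case base then show ?case by (simp add: box_span_def mpoly.span_zero)
next
  case (step c m p)
  then obtain a where a: "a \<in> Z \<rightarrow>\<^sub>E {..d}" "m = (\<Prod>z\<in>Z. z ^ a z)" by blast
  have "m * q \<in> box_span Z (d + d')"
    using assms(2) unfolding box_span_def[of Z d']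
  proof (induction rule: mpoly.span_induct_alt)
    case base then show ?case by (simp add: box_span_def mpoly.span_zero)
  next
    case (step c m' q)
    then obtain b where b: "b \<in> Z \<rightarrow>\<^sub>E {..d'}" "m' = (\<Prod>z\<in>Z. z ^ b z)" by blast
    have "m * m' = (\<Prod>z\<in>Z. z ^ (a z + b z))" by (simp add: a b power_add prod.distrib)
    moreover have "a z + b z \<le> d + d'" if "z \<in> Z" for z
      using PiE_mem[OF a(1) that] PiE_mem[OF b(1) that] by simp
    ultimately have "m * m' \<in> box_span Z (d + d')" using box_span_memI[of Z "\<lambda>z. a z + b z"] by simp
    then have "cst c * (m * m') + m * q \<in> box_span Z (d + d')"
      using step.IH unfolding box_span_def by (intro mpoly.span_add mpoly.span_scale)
    then show ?case by (simp add: algebra_simps)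
  qed
  then have "cst c * (m * q) + p * q \<in> box_span Z (d + d')"
    using step.IH unfolding box_span_def by (intro mpoly.span_add mpoly.span_scale)
  then show ?case by (simp add: algebra_simps)
qed

lemma alg_box_span:
  assumes "alg Z p" "finite Z"
  shows "\<exists>d. p \<in> box_span Z d"
  using assms(1)
proof induction
  case (const c)
  have "(\<Prod>z\<in>Z. z ^ (0::nat)) \<in> box_span Z 0" by (rule box_span_memI) simp
  then have "cst c * 1 \<in> box_span Z 0"
    unfolding box_span_def by (intro mpoly.span_scale) simp
  then show ?case by auto
next
  case (gen y)
  have "(\<Prod>z\<in>Z. z ^ (if z = y then 1 else 0)) \<in> box_span Z 1" by (rule box_span_memI) simp
  also have "(\<Prod>z\<in>Z. z ^ (if z = y then 1 else 0 :: nat)) = (\<Prod>z\<in>Z. if z = y then z else 1)"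
    by (rule prod.cong) auto
  also have "\<dots> = y" using assms(2) gen by simp
  finally show ?case by blast
next
  case (add p q)
  then obtain d d' where "p \<in> box_span Z d" "q \<in> box_span Z d'" by blast
  then have "p \<in> box_span Z (max d d')" "q \<in> box_span Z (max d d')"
    using box_span_mono[of d "max d d'" Z] box_span_mono[of d' "max d d'" Z] by auto
  then have "p + q \<in> box_span Z (max d d')" unfolding box_span_def by (rule mpoly.span_add)
  then show ?case ..
qed (blast intro: box_span_mult)

lemma alg_zero: "alg Z 0" using alg.const[of Z 0] by simp
lemma alg_one: "alg Z 1" using alg.const[of Z 1] by simp
lemma alg_diff: "alg Z p \<Longrightarrow> alg Z q \<Longrightarrow> alg Z (p - q)"
  using alg.add[of Z p "cst (- 1) * q"] alg.mult[OF alg.const, of Z q "- 1"]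
  by (simp add: single_uminus)

lemma box_span_prod_power:
  assumes "\<And>i. i < n \<Longrightarrow> y i \<in> box_span Z d" "\<And>i. i < n \<Longrightarrow> e i \<le> k"
  shows "(\<Prod>i<n. y i ^ e i) \<in> box_span Z (n * (k * d))"
proof -
  have one: "1 \<in> box_span Z d" for d using box_span_memI[of Z "\<lambda>_. 0" d] by simp
  have pow: "p ^ m \<in> box_span Z (m * d)" if "p \<in> box_span Z d" for p m
    by (induction m) (auto intro: one box_span_mult that)
  have "y i ^ e i \<in> box_span Z (k * d)" if "i < n" for i
    using pow[OF assms(1)[OF that], of "e i"] box_span_mono[of "e i * d" "k * d" Z] assms(2)[OF that]
    by (auto simp: mult_le_mono)
  then show ?thesis
  proof (induction n)
    case (Suc n)
    then have "(\<Prod>i<n. y i ^ e i) * y n ^ e n \<in> box_span Z (n * (k * d) + k * d)"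
      by (intro box_span_mult) auto
    then show ?case by (simp add: add.commute)
  qed (simp add: one)
qed

text \<open>If the monomials were independent, those with exponents at most \<open>k\<close> would span a
  space of dimension \<open>(k + 1) ^ n\<close> inside one of dimension \<open>O(k ^ card Z)\<close>.\<close>

lemma alg_card_bound:
  fixes y :: "nat \<Rightarrow> ('x \<Rightarrow>\<^sub>0 nat) \<Rightarrow>\<^sub>0 'a::field"
  assumes Z: "finite Z" and y: "\<And>i. i < n \<Longrightarrow> alg Z (y i)"
    and indep: "\<And>E c. finite E \<Longrightarrow> E \<subseteq> {..<n} \<rightarrow>\<^sub>E UNIV \<Longrightarrow>
      (\<Sum>e\<in>E. cst (c e) * (\<Prod>i<n. y i ^ e i)) = 0 \<Longrightarrow> \<forall>e\<in>E. c e = 0"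
  shows "n \<le> card Z"
proof (rule ccontr)
  assume "\<not> n \<le> card Z"
  then have n: "Suc (card Z) \<le> n" by simp
  have "\<forall>i<n. \<exists>d. y i \<in> box_span Z d" using alg_box_span[OF y Z] by blast
  then obtain D where D: "\<And>i. i < n \<Longrightarrow> y i \<in> box_span Z (D i)" by metis
  define d where "d = Suc (\<Sum>i<n. D i)"
  have yd: "y i \<in> box_span Z d" if "i < n" for i
  proof -
    have "D i \<le> d" unfolding d_def using member_le_sum[of i "{..<n}" D] that by simp
    then show ?thesis using D[OF that] box_span_mono by blast
  qed
  define mon where "mon e = (\<Prod>i<n. y i ^ e i)" for e
  \<comment> \<open>Chosen to absorb the constant factor: \<open>(n * (k * d) + 1) ^ card Z\<close>
    is at most \<open>(n * d + 1) ^ card Z * (k + 1) ^ card Z\<close>, which is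
    \<open>k * (k + 1) ^ card Z\<close> and so falls below the next power of
    \<open>k + 1\<close>.\<close>
  define k where "k = (n * d + 1) ^ card Z"
  let ?E = "{..<n} \<rightarrow>\<^sub>E {..k}"
  let ?T = "(\<lambda>a. \<Prod>z\<in>Z. z ^ a z) ` (Z \<rightarrow>\<^sub>E {..n * (k * d)})"
  have finE: "finite ?E" by (simp add: finite_PiE)
  have inj: "inj_on mon ?E"
  proof (rule inj_onI, rule ccontr)
    fix e e' assume e: "e \<in> ?E" "e' \<in> ?E" "mon e = mon e'" "e \<noteq> e'"
    \<comment> \<open>Equal monomials with different exponents would already be a relation, with
      coefficients 1 and -1.\<close>
    have "(\<Sum>f\<in>{e, e'}. cst (if f = e then 1 else - 1) * (\<Prod>i<n. y i ^ f i)) = 0"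
      using e by (simp add: mon_def single_uminus)
    from indep[OF _ _ this] e show False by (auto split: if_splits simp: PiE_iff)
  qed
  have "mpoly.independent (mon ` ?E)"
    unfolding mpoly.independent_explicit_module
  proof (intro allI impI)
    fix t u v assume t: "finite t" "t \<subseteq> mon ` ?E" "(\<Sum>v\<in>t. cst (u v) * v) = 0" "v \<in> t"
    define E where "E = {e\<in>?E. mon e \<in> t}"
    have im: "mon ` E = t" using t(2) by (auto simp: E_def)
    have "inj_on mon E" using inj by (rule inj_on_subset) (auto simp: E_def)
    then have "(\<Sum>e\<in>E. cst (u (mon e)) * mon e) = 0"
      using t(3) sum.reindex[of mon E "\<lambda>v. cst (u v) * v"] im by simp
    moreover have "finite E" "E \<subseteq> {..<n} \<rightarrow>\<^sub>E UNIV"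
      using finE PiE_mono[of "{..<n}" "\<lambda>_. {..k}" "\<lambda>_. UNIV"] by (auto simp: E_def)
    ultimately have "\<forall>e\<in>E. u (mon e) = 0"
      unfolding mon_def by (intro indep)
    then show "u v = 0" using im t(4) by blast
  qed
  moreover have "mon ` ?E \<subseteq> mpoly.span ?T"
  proof
    fix p assume "p \<in> mon ` ?E"
    then obtain e where "e \<in> ?E" "p = mon e" by blast
    then have "p \<in> box_span Z (n * (k * d))"
      unfolding mon_def using yd by (auto intro!: box_span_prod_power)
    then show "p \<in> mpoly.span ?T" by (simp add: box_span_def)
  qed
  moreover have "finite ?T" using Z by (simp add: finite_PiE)
  ultimately have "card (mon ` ?E) \<le> card ?T"
    using mpoly.independent_span_bound by blast
  also have "\<dots> \<le> card (Z \<rightarrow>\<^sub>E {..n * (k * d)})" using Z by (intro card_image_le) (simp add: finite_PiE)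
  also have "\<dots> = (n * (k * d) + 1) ^ card Z" using Z by (simp add: card_PiE)
  finally have "(k + 1) ^ n \<le> (n * (k * d) + 1) ^ card Z"
    using card_image[OF inj] by (simp add: card_PiE)
  also have "\<dots> \<le> ((n * d + 1) * (k + 1)) ^ card Z"
    by (rule power_mono) (simp_all add: algebra_simps)
  also have "\<dots> = k * (k + 1) ^ card Z" unfolding k_def by (rule power_mult_distrib)
  also have "\<dots> < (k + 1) ^ Suc (card Z)" by simp
  also have "\<dots> \<le> (k + 1) ^ n" using n by (intro power_increasing) auto
  finally show False by simp
qed

section \<open>Monomial substitutions and forms\<close>

text \<open>This serves twice: as the exponent of \<open>x0\<close> that a substitution adds, and
  with \<open>M = UNIV\<close> as the total degree.\<close>

definition wt :: "'x set \<Rightarrow> ('x \<Rightarrow>\<^sub>0 nat) \<Rightarrow> nat" where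
  "wt M t = (\<Sum>x\<in>Poly_Mapping.keys t \<inter> M. Poly_Mapping.lookup t x)"

lemma wt_superset:
  assumes "finite K" "Poly_Mapping.keys t \<subseteq> K"
  shows "wt M t = (\<Sum>x\<in>K \<inter> M. Poly_Mapping.lookup t x)"
  unfolding wt_def using assms by (intro sum.mono_neutral_left) (auto simp: in_keys_iff)

lemma wt_add [simp]: "wt M (s + t) = wt M s + wt M t"
proof -
  let ?K = "Poly_Mapping.keys s \<union> Poly_Mapping.keys t"
  have "Poly_Mapping.keys (s + t) \<subseteq> ?K" by (rule Poly_Mapping.keys_add)
  then show ?thesis
    by (simp add: wt_superset[of ?K] lookup_add sum.distrib)
qed

lemma wt_zero [simp]: "wt M 0 = 0" by (simp add: wt_def)

lemma wt_single [simp]: "wt M (Poly_Mapping.single x n) = (if x \<in> M then n else 0)"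
  by (simp add: wt_def)

lemma wt_cong: "(\<And>x. x \<in> M \<Longrightarrow> Poly_Mapping.lookup s x = Poly_Mapping.lookup t x) \<Longrightarrow> wt M s = wt M t"
  unfolding wt_superset[of "Poly_Mapping.keys s \<union> Poly_Mapping.keys t" s, simplified]
    wt_superset[of "Poly_Mapping.keys s \<union> Poly_Mapping.keys t" t, simplified]
  by (rule sum.cong) auto

lemma poly_mapping_eq_sum_single:
  "(\<Sum>t\<in>Poly_Mapping.keys p. Poly_Mapping.single t (Poly_Mapping.lookup p t)) = p"
  by (rule poly_mapping_eqI) (simp add: lookup_sum lookup_single when_def in_keys_iff)

text \<open>The substitution \<open>x \<mapsto> x\<^sub>0 x\<close> for \<open>x \<in> M\<close>, with the other variables fixed.\<close>

definition scale_exp :: "'x \<Rightarrow> 'x set \<Rightarrow> ('x \<Rightarrow>\<^sub>0 nat) \<Rightarrow> ('x \<Rightarrow>\<^sub>0 nat)" where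
  "scale_exp x0 M t = t + Poly_Mapping.single x0 (wt M t)"

definition scale :: "'x \<Rightarrow> 'x set \<Rightarrow> (('x \<Rightarrow>\<^sub>0 nat) \<Rightarrow>\<^sub>0 'a::field) \<Rightarrow> (('x \<Rightarrow>\<^sub>0 nat) \<Rightarrow>\<^sub>0 'a)" where
  "scale x0 M p = (\<Sum>t\<in>Poly_Mapping.keys p.
     Poly_Mapping.single (scale_exp x0 M t) (Poly_Mapping.lookup p t))"

lemma scale_exp_add: "scale_exp x0 M (s + t) = scale_exp x0 M s + scale_exp x0 M t"
  by (simp add: scale_exp_def single_add add_ac)

text \<open>The exponents at \<open>M\<close> survive because \<open>x0 \<notin> M\<close>, so
  \<open>wt M\<close> can be read off the image and the added power of \<open>x0\<close> removed
  again.\<close>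

lemma inj_scale_exp:
  assumes "x0 \<notin> M"
  shows "inj (scale_exp x0 M)"
proof (rule injI)
  fix s t assume eq: "scale_exp x0 M s = scale_exp x0 M t"
  have "wt M s = wt M t"
  proof (rule wt_cong)
    fix x assume "x \<in> M"
    then show "Poly_Mapping.lookup s x = Poly_Mapping.lookup t x"
      using arg_cong[OF eq, of "\<lambda>u. Poly_Mapping.lookup u x"] assms
      by (cases "x0 = x") (auto simp: scale_exp_def lookup_add lookup_single)
  qed
  with eq show "s = t" by (simp add: scale_exp_def)
qed

lemma scale_superset:
  assumes "finite K" "Poly_Mapping.keys p \<subseteq> K"
  shows "scale x0 M p =
    (\<Sum>t\<in>K. Poly_Mapping.single (scale_exp x0 M t) (Poly_Mapping.lookup p t))"
  unfolding scale_def using assms by (intro sum.mono_neutral_left) (auto simp: in_keys_iff)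

lemma scale_add: "scale x0 M (p + q) = scale x0 M p + scale x0 M q"
proof -
  let ?K = "Poly_Mapping.keys p \<union> Poly_Mapping.keys q"
  have "Poly_Mapping.keys (p + q) \<subseteq> ?K" by (rule Poly_Mapping.keys_add)
  then show ?thesis
    by (simp add: scale_superset[of ?K] lookup_add single_add sum.distrib)
qed

lemma scale_zero [simp]: "scale x0 M 0 = 0" by (simp add: scale_def)

lemma scale_sum: "scale x0 M (\<Sum>i\<in>A. g i) = (\<Sum>i\<in>A. scale x0 M (g i))"
  by (induction A rule: infinite_finite_induct) (simp_all add: scale_add)

lemma scale_single: "scale x0 M (Poly_Mapping.single t c) = Poly_Mapping.single (scale_exp x0 M t) c"
  by (simp add: scale_def)

lemma scale_cst [simp]: "scale x0 M (cst c) = cst c"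
  by (simp add: scale_single scale_exp_def)

lemma scale_one [simp]: "scale x0 M 1 = 1"
  using scale_cst[of x0 M 1] by simp

lemma scale_mvar: "scale x0 M (mvar x) = (if x \<in> M then mvar x0 * mvar x else mvar x)"
  by (simp add: mvar_def scale_single scale_exp_def mult_single add.commute)

lemma scale_mult: "scale x0 M (p * q) = scale x0 M p * scale x0 M q"
proof -
  have single: "scale x0 M (Poly_Mapping.single s a * Poly_Mapping.single t b) =
      scale x0 M (Poly_Mapping.single s a) * scale x0 M (Poly_Mapping.single t b)" for s t a b
    by (simp add: mult_single scale_single scale_exp_add)
  have "scale x0 M (p * q) = scale x0 M
      ((\<Sum>s\<in>Poly_Mapping.keys p. Poly_Mapping.single s (Poly_Mapping.lookup p s)) *
       (\<Sum>t\<in>Poly_Mapping.keys q. Poly_Mapping.single t (Poly_Mapping.lookup q t)))"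
    by (simp only: poly_mapping_eq_sum_single)
  also have "\<dots> = scale x0 M
      (\<Sum>s\<in>Poly_Mapping.keys p. Poly_Mapping.single s (Poly_Mapping.lookup p s)) *
     scale x0 M (\<Sum>t\<in>Poly_Mapping.keys q. Poly_Mapping.single t (Poly_Mapping.lookup q t))"
    by (simp only: sum_product scale_sum single)
  finally show ?thesis by (simp only: poly_mapping_eq_sum_single)
qed

lemma scale_diff: "scale x0 M (p - q) = scale x0 M p - scale x0 M q"
  using scale_add[of x0 M "p - q" q] by simp

lemma scale_power: "scale x0 M (p ^ n) = scale x0 M p ^ n"
  by (induction n) (simp_all add: scale_mult)

lemma scale_prod: "scale x0 M (\<Prod>i\<in>S. g i) = (\<Prod>i\<in>S. scale x0 M (g i))"
  by (induction S rule: infinite_finite_induct) (simp_all add: scale_mult)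

lemma scale_eq_0:
  assumes "x0 \<notin> M" "scale x0 M p = 0"
  shows "p = 0"
proof (rule poly_mapping_eqI)
  fix t
  have "Poly_Mapping.lookup (scale x0 M p) (scale_exp x0 M t) =
      (\<Sum>s\<in>Poly_Mapping.keys p. if s = t then Poly_Mapping.lookup p s else 0)"
    unfolding scale_def lookup_sum
    by (rule sum.cong) (auto simp: lookup_single when_def inj_eq[OF inj_scale_exp[OF assms(1)]])
  then show "Poly_Mapping.lookup p t = Poly_Mapping.lookup 0 t"
    using assms(2) by (simp add: in_keys_iff split: if_splits)
qed

section \<open>Forms in the generators and the graded algebra they make up\<close>

inductive form :: "(('x \<Rightarrow>\<^sub>0 nat) \<Rightarrow>\<^sub>0 'a::field) set \<Rightarrow> nat \<Rightarrow> (('x \<Rightarrow>\<^sub>0 nat) \<Rightarrow>\<^sub>0 'a) \<Rightarrow> bool"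
  for F where
  const: "form F 0 (cst c)"
| zero: "form F k 0"
| step: "form F k p \<Longrightarrow> f \<in> F \<Longrightarrow> form F (Suc k) (p * f)"
| add: "form F k p \<Longrightarrow> form F k q \<Longrightarrow> form F k (p + q)"

lemma form_cst_mult: "form F k p \<Longrightarrow> form F k (cst c * p)"
proof (induction rule: form.induct)
  case (step k p f)
  then have "form F (Suc k) ((cst c * p) * f)" by (intro form.step)
  then show ?case by (simp add: mult.assoc)
qed (auto simp: mult_single distrib_left intro: form.intros)

lemma form_mult: "form F l q \<Longrightarrow> form F k p \<Longrightarrow> form F (k + l) (p * q)"
proof (induction rule: form.induct)
  case (const c) then show ?case using form_cst_mult[of F k p c] by (simp add: mult.commute)
next
  case (step l q f)
  then have "form F (Suc (k + l)) ((p * q) * f)" by (intro form.step)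
  then show ?case by (simp add: mult.assoc)
qed (auto simp: distrib_left intro: form.intros)

lemma form_sum: "(\<And>i. i \<in> A \<Longrightarrow> form F k (g i)) \<Longrightarrow> form F k (\<Sum>i\<in>A. g i)"
  by (induction A rule: infinite_finite_induct) (auto intro: form.intros)

definition homogeneous :: "nat \<Rightarrow> (('x \<Rightarrow>\<^sub>0 nat) \<Rightarrow>\<^sub>0 'a::field) \<Rightarrow> bool" where
  "homogeneous d p \<longleftrightarrow> (\<forall>t\<in>Poly_Mapping.keys p. wt UNIV t = d)"

lemma homogeneous_add: "homogeneous d p \<Longrightarrow> homogeneous d q \<Longrightarrow> homogeneous d (p + q)"
  using Poly_Mapping.keys_add[of p q] unfolding homogeneous_def by blast

lemma homogeneous_diff: "homogeneous d p \<Longrightarrow> homogeneous d q \<Longrightarrow> homogeneous d (p - q)"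
  unfolding homogeneous_def by (auto simp: in_keys_iff lookup_minus)

lemma homogeneous_mult:
  assumes "homogeneous d p" "homogeneous d' q" shows "homogeneous (d + d') (p * q)"
  unfolding homogeneous_def
proof
  fix t assume "t \<in> Poly_Mapping.keys (p * q)"
  then obtain u v where "t = u + v" "u \<in> Poly_Mapping.keys p" "v \<in> Poly_Mapping.keys q"
    using keys_mult[of p q] by blast
  then show "wt UNIV t = d + d'" using assms by (simp add: homogeneous_def)
qed

lemma homogeneous_mvar: "homogeneous 1 (mvar x)"
  by (simp add: homogeneous_def mvar_def)

lemma form_homogeneous:
  assumes "\<And>f. f \<in> F \<Longrightarrow> homogeneous d f"
  shows "form F k p \<Longrightarrow> homogeneous (k * d) p"
proof (induction rule: form.induct)
  case (step k p f)
  then have "homogeneous (k * d + d) (p * f)" by (intro homogeneous_mult assms)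
  then show ?case by (simp add: add.commute)
qed (auto simp: homogeneous_def[of _ "cst _"] homogeneous_def[of _ 0] intro: homogeneous_add)

lemma form_alg_scale:
  assumes "\<And>f. f \<in> F \<Longrightarrow> alg Z (scale x0 M f)"
  shows "form F k p \<Longrightarrow> alg Z (scale x0 M p)"
  by (induction rule: form.induct)
    (auto simp: scale_add scale_mult alg_zero intro: alg.const alg.add alg.mult assms)

text \<open>The coefficient of degree \<open>k\<close> is a \<open>k\<close>-form in
  \<open>F\<close> with coefficients in the field, not in the polynomial ring. Hence this is only
  the subalgebra of the Rees algebra generated over the field by the multiples of the Rees variable
  by elements of \<open>F\<close>. It still maps onto the special fiber ring, where the graded
  maximal ideal acts as zero.\<close>

definition rees :: "(('x \<Rightarrow>\<^sub>0 nat) \<Rightarrow>\<^sub>0 'a::field) set \<Rightarrow> (('x \<Rightarrow>\<^sub>0 nat) \<Rightarrow>\<^sub>0 'a) poly set" where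
  "rees F = {q. \<forall>k. form F k (Polynomial.coeff q k)}"

lemma rees_const: "[:cst c:] \<in> rees F"
  unfolding rees_def by (auto simp: coeff_pCons split: nat.split intro: form.intros)

lemma rees_add: "p \<in> rees F \<Longrightarrow> q \<in> rees F \<Longrightarrow> p + q \<in> rees F"
  unfolding rees_def by (auto intro: form.add)

lemma rees_mult:
  assumes "p \<in> rees F" "q \<in> rees F" shows "p * q \<in> rees F"
  unfolding rees_def
proof (intro CollectI allI)
  fix n
  have "form F n (Polynomial.coeff p i * Polynomial.coeff q (n - i))" if "i \<le> n" for i
    using form_mult[of F "n - i" "Polynomial.coeff q (n - i)" i "Polynomial.coeff p i"] assms that
    by (simp add: rees_def)
  then show "form F n (Polynomial.coeff (p * q) n)"
    unfolding Polynomial.coeff_mult by (intro form_sum) auto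
qed

text \<open>Setting the Rees variable to 1 loses nothing, because the coefficients live in
  different degrees.\<close>

lemma rees_poly_1_eq_0:
  assumes F: "\<And>f. f \<in> F \<Longrightarrow> homogeneous d f" and "d > 0" and q: "q \<in> rees F" "poly q 1 = 0"
  shows "q = 0"
proof (rule poly_eqI, rule poly_mapping_eqI, rule ccontr)
  fix k t
  assume nz: "Poly_Mapping.lookup (Polynomial.coeff q k) t \<noteq> Poly_Mapping.lookup (Polynomial.coeff 0 k) t"
  have hom: "homogeneous (i * d) (Polynomial.coeff q i)" for i
    using q(1) by (intro form_homogeneous[OF F]) (auto simp: rees_def)
  have t: "wt UNIV t = k * d" using hom[of k] nz by (auto simp: homogeneous_def in_keys_iff)
  have z: "Poly_Mapping.lookup (Polynomial.coeff q i) t = 0" if "i \<noteq> k" for i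
  proof (rule ccontr)
    assume "Poly_Mapping.lookup (Polynomial.coeff q i) t \<noteq> 0"
    then have "wt UNIV t = i * d" using hom[of i] by (simp add: homogeneous_def in_keys_iff)
    with t that \<open>d > 0\<close> show False by simp
  qed
  have "k \<le> Polynomial.degree q" using nz by (metis Polynomial.coeff_0 le_degree)
  have "Poly_Mapping.lookup (poly q 1) t =
      (\<Sum>i\<le>Polynomial.degree q. Poly_Mapping.lookup (Polynomial.coeff q i) t)"
    by (simp add: poly_altdef lookup_sum)
  also have "\<dots> = (\<Sum>i\<in>{k}. Poly_Mapping.lookup (Polynomial.coeff q i) t)"
    using z \<open>k \<le> Polynomial.degree q\<close> by (intro sum.mono_neutral_right) auto
  finally show False using nz q(2) by simp
qed

section \<open>The special fiber ring\<close>

lemma mpoly_ring_simps [simp]: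
  "x \<otimes>\<^bsub>mpoly_ring X\<^esub> y = x * y" "\<one>\<^bsub>mpoly_ring X\<^esub> = 1" "\<zero>\<^bsub>mpoly_ring X\<^esub> = 0"
  "x \<oplus>\<^bsub>mpoly_ring X\<^esub> y = x + y"
  by (simp_all add: mpoly_ring_def)

lemma mpoly_ring_carrier:
  "p \<in> carrier (mpoly_ring X) \<longleftrightarrow> (\<forall>t\<in>Poly_Mapping.keys p. Poly_Mapping.keys t \<subseteq> X)"
  by (simp add: mpoly_ring_def)

lemma ideal_mpoly_ringD:
  assumes "ideal I (mpoly_ring X)"
  shows "0 \<in> I" "a \<in> I \<Longrightarrow> b \<in> I \<Longrightarrow> a + b \<in> I" "a \<in> I \<Longrightarrow> a \<in> carrier (mpoly_ring X)"
    "a \<in> I \<Longrightarrow> b \<in> carrier (mpoly_ring X) \<Longrightarrow> a * b \<in> I"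
    "a \<in> I \<Longrightarrow> b \<in> carrier (mpoly_ring X) \<Longrightarrow> b * a \<in> I"
  using additive_subgroup.zero_closed[OF ideal.axioms(1)[OF assms]]
    additive_subgroup.a_closed[OF ideal.axioms(1)[OF assms]]
    ideal.Icarr[OF assms] ideal.I_r_closed[OF assms] ideal.I_l_closed[OF assms] by auto

lemma ideal_mpoly_ring_sum:
  assumes "ideal I (mpoly_ring X)" "\<And>i. i \<in> A \<Longrightarrow> g i \<in> I"
  shows "(\<Sum>i\<in>A. g i) \<in> I"
  using assms(2) by (induction A rule: infinite_finite_induct) (auto intro: ideal_mpoly_ringD[OF assms(1)])

text \<open>Every nonconstant monomial is divisible by one of the variables.\<close>

lemma minus_cst_in_graded_maximal_ideal:
  fixes p :: "('x \<Rightarrow>\<^sub>0 nat) \<Rightarrow>\<^sub>0 'a::field"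
  assumes "p \<in> carrier (mpoly_ring X)"
  shows "p - cst (Poly_Mapping.lookup p 0) \<in> graded_maximal_ideal X"
proof -
  interpret cring "mpoly_ring X :: (('x \<Rightarrow>\<^sub>0 nat) \<Rightarrow>\<^sub>0 'a) ring" by (rule cring_mpoly_ring)
  have sub: "mvar ` X \<subseteq> carrier (mpoly_ring X :: (('x \<Rightarrow>\<^sub>0 nat) \<Rightarrow>\<^sub>0 'a) ring)"
    by (auto simp: mpoly_ring_carrier mvar_def)
  have M: "ideal (graded_maximal_ideal X :: (('x \<Rightarrow>\<^sub>0 nat) \<Rightarrow>\<^sub>0 'a) set) (mpoly_ring X)"
    unfolding graded_maximal_ideal_def by (rule genideal_ideal[OF sub])
  have single: "Poly_Mapping.single t c \<in> graded_maximal_ideal X"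
    if t: "Poly_Mapping.keys t \<subseteq> X" "t \<noteq> 0" for t and c :: 'a
  proof -
    have "Poly_Mapping.keys t \<noteq> {}" using t(2) by simp
    then obtain x where x: "x \<in> Poly_Mapping.keys t" by blast
    define u where "u = t - Poly_Mapping.single x 1"
    have "Poly_Mapping.lookup t x \<ge> 1" using x by (simp add: in_keys_iff)
    then have tu: "t = Poly_Mapping.single x 1 + u"
      unfolding u_def by (intro poly_mapping_eqI) (auto simp: lookup_add lookup_minus lookup_single when_def)
    have "Poly_Mapping.keys u \<subseteq> Poly_Mapping.keys t"
      unfolding u_def by (auto simp: in_keys_iff lookup_minus)
    then have u: "Poly_Mapping.single u c \<in> carrier (mpoly_ring X)"
      using t by (auto simp: mpoly_ring_carrier)
    have "mvar x \<in> (graded_maximal_ideal X :: (('x \<Rightarrow>\<^sub>0 nat) \<Rightarrow>\<^sub>0 'a) set)"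
      using genideal_self[OF sub] x t unfolding graded_maximal_ideal_def by blast
    from ideal_mpoly_ringD(4)[OF M this u] show ?thesis
      by (simp add: mvar_def mult_single tu)
  qed
  have "(\<Sum>t\<in>Poly_Mapping.keys p - {0}. Poly_Mapping.single t (Poly_Mapping.lookup p t))
      \<in> graded_maximal_ideal X"
    using assms by (intro ideal_mpoly_ring_sum[OF M] single) (auto simp: mpoly_ring_carrier)
  also have "(\<Sum>t\<in>Poly_Mapping.keys p - {0}. Poly_Mapping.single t (Poly_Mapping.lookup p t)) =
      p - cst (Poly_Mapping.lookup p 0)"
    by (rule poly_mapping_eqI)
      (auto simp: lookup_sum lookup_minus lookup_single when_def in_keys_iff)
  finally show ?thesis .
qed

section \<open>The graded algebra of forms maps onto the special fiber ring\<close>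

locale fiber =
  fixes X :: "'x set" and F :: "(('x \<Rightarrow>\<^sub>0 nat) \<Rightarrow>\<^sub>0 'a::field) set"
  assumes F_carrier: "F \<subseteq> carrier (mpoly_ring X)"
begin

abbreviation "R \<equiv> mpoly_ring X :: (('x \<Rightarrow>\<^sub>0 nat) \<Rightarrow>\<^sub>0 'a) ring"
abbreviation "M \<equiv> graded_maximal_ideal X :: (('x \<Rightarrow>\<^sub>0 nat) \<Rightarrow>\<^sub>0 'a) set"
abbreviation "I \<equiv> genideal R F"
abbreviation "K \<equiv> ideal_power R I"
abbreviation "J k \<equiv> ideal_prod R M (K k)"
abbreviation "A \<equiv> special_fiber_ring R M I"

sublocale cring R by (rule cring_mpoly_ring)

lemma ideal_I: "ideal I R"
  by (rule genideal_ideal[OF F_carrier])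

lemma ideal_M: "ideal M R"
  unfolding graded_maximal_ideal_def by (rule genideal_ideal) (auto simp: mpoly_ring_carrier mvar_def)

lemma ideal_K: "ideal (K k) R"
  by (induction k) (simp_all add: ideal_power_simps oneideal ideal_prod_is_ideal ideal_I)

lemma ideal_J: "ideal (J k) R"
  by (rule ideal_prod_is_ideal[OF ideal_M ideal_K])

lemma cst_carrier: "cst c \<in> carrier R"
  by (simp add: mpoly_ring_carrier)

lemma form_K: "form F k p \<Longrightarrow> p \<in> K k"
proof (induction rule: form.induct)
  case (const c) then show ?case by (simp add: ideal_power_simps cst_carrier)
next
  case (zero k) show ?case by (rule ideal_mpoly_ringD(1)[OF ideal_K])
next
  case (step k p f)
  then have "f \<in> I" using genideal_self[OF F_carrier] by blast
  then show ?case using step ideal_prod.prod[of p "K k" f I R] by (simp add: ideal_power_simps)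
next
  case (add k p q) then show ?case by (intro ideal_mpoly_ringD(2)[OF ideal_K])
qed

text \<open>Modulo the maximal ideal, polynomial coefficients may be replaced by their constant
  terms, so only products of generators with constant coefficients survive. This gives the
  surjectivity of \<open>to_fiber\<close>.\<close>

lemma K_decompose: "a \<in> K k \<Longrightarrow> \<exists>v. form F k v \<and> a - v \<in> J k"
proof (induction k arbitrary: a)
  case 0
  then have "a \<in> carrier R" by (simp add: ideal_power_simps)
  then have "a - cst (Poly_Mapping.lookup a 0) \<in> J 0"
    using minus_cst_in_graded_maximal_ideal[of a X] ideal_M
    by (simp add: ideal_power_simps ideal_prod_one)
  then show ?case using form.const by blast
next
  case (Suc k)
  define L where "L = {a. \<exists>v. form F (Suc k) v \<and> a - v \<in> J (Suc k)}"
  have L_add: "a + b \<in> L" if ab: "a \<in> L" "b \<in> L" for a b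
  proof -
    obtain v w where "form F (Suc k) v" "a - v \<in> J (Suc k)" "form F (Suc k) w" "b - w \<in> J (Suc k)"
      using ab unfolding L_def by blast
    then have "form F (Suc k) (v + w) \<and> (a + b) - (v + w) \<in> J (Suc k)"
      using ideal_mpoly_ringD(2)[OF ideal_J[of "Suc k"], of "a - v" "b - w"]
      by (auto simp: algebra_simps intro: form.add)
    then show ?thesis by (auto simp: L_def)
  qed
  \<comment> \<open>A colon ideal in disguise: once it is an ideal containing \<open>F\<close> it
    contains \<open>I\<close>, and then \<open>L\<close> contains every product of an element of
    \<open>K k\<close> with one of \<open>I\<close>.\<close>
  define T where "T = {b \<in> carrier R. \<forall>a\<in>K k. a * b \<in> L}"
  have L0: "0 \<in> L"
    unfolding L_def using form.zero[of F "Suc k"] ideal_mpoly_ringD(1)[OF ideal_J[of "Suc k"]] by force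
  have "ideal T R"
  proof (rule idealI)
    show "ring R" by (rule ring_axioms)
    show "subgroup T (add_monoid R)"
    proof
      show "T \<subseteq> carrier (add_monoid R)" by (auto simp: T_def)
      show "x \<otimes>\<^bsub>add_monoid R\<^esub> y \<in> T" if "x \<in> T" "y \<in> T" for x y
        using that a_closed[of x y] by (auto simp: T_def distrib_left intro: L_add)
      show "\<one>\<^bsub>add_monoid R\<^esub> \<in> T" using zero_closed by (auto simp: T_def L0)
      fix x assume x: "x \<in> T"
      then have xc: "x \<in> carrier R" by (simp add: T_def)
      have "\<ominus>\<^bsub>R\<^esub> x + x = 0" using l_neg[OF xc] by simp
      then have neg: "\<ominus>\<^bsub>R\<^esub> x = - x" by (rule eq_neg_iff_add_eq_0[THEN iffD2])
      have "- x \<in> carrier R" using a_inv_closed[OF xc] neg by simp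
      moreover have "a * - x \<in> L" if "a \<in> K k" for a
      proof -
        \<comment> \<open>\<open>L\<close> is known only to be closed under sums, so the sign is
          moved onto \<open>a\<close>, where the ideal \<open>K k\<close> absorbs it.\<close>
        have "a * cst (- 1) \<in> K k" by (rule ideal_mpoly_ringD(4)[OF ideal_K that cst_carrier])
        then have "(a * cst (- 1)) * x \<in> L" using x by (auto simp: T_def)
        then show ?thesis by (simp add: single_uminus)
      qed
      ultimately show "inv\<^bsub>add_monoid R\<^esub> x \<in> T"
        unfolding a_inv_def[symmetric] using neg by (simp add: T_def)
    qed
  next
    fix b r assume b: "b \<in> T" and r: "r \<in> carrier R"
    have "a * (r * b) \<in> L" if "a \<in> K k" for a
      using b ideal_mpoly_ringD(4)[OF ideal_K that r] by (auto simp: T_def mult.assoc[symmetric])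
    moreover have "r * b \<in> carrier R" using m_closed[OF r, of b] b by (simp add: T_def)
    ultimately have "r * b \<in> T" by (simp add: T_def)
    then show "r \<otimes>\<^bsub>R\<^esub> b \<in> T" "b \<otimes>\<^bsub>R\<^esub> r \<in> T" by (simp_all add: mult.commute)
  qed
  moreover have "F \<subseteq> T"
  proof
    fix f assume f: "f \<in> F"
    have "a * f \<in> L" if a: "a \<in> K k" for a
    proof -
      obtain v where v: "form F k v" "a - v \<in> J k" using Suc.IH[OF a] by blast
      have "f \<in> I" using f genideal_self[OF F_carrier] by blast
      then have "(a - v) * f \<in> ideal_prod R (J k) I"
        using ideal_prod.prod[OF v(2), of f I R] by simp
      then have "a * f - v * f \<in> J (Suc k)"
        using ideal_prod_assoc[OF ideal_M ideal_K ideal_I] by (simp add: ideal_power_simps left_diff_distrib)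
      then show ?thesis using form.step[OF v(1) f] by (auto simp: L_def)
    qed
    then show "f \<in> T" using f F_carrier by (auto simp: T_def)
  qed
  ultimately have "I \<subseteq> T" by (rule genideal_minimal)
  have "a \<in> ideal_prod R (K k) I" using Suc.prems by (simp add: ideal_power_simps)
  then have "a \<in> L"
  proof induction
    case (prod i j) then show ?case using \<open>I \<subseteq> T\<close> by (auto simp: T_def)
  next
    case (sum s t) then show ?case by (simp add: L_add)
  qed
  then show ?case by (simp add: L_def)
qed

lemma K_mult: "a \<in> K i \<Longrightarrow> b \<in> K j \<Longrightarrow> a * b \<in> K (i + j)"
  and J_mult: "a \<in> J i \<Longrightarrow> b \<in> K j \<Longrightarrow> a * b \<in> J (i + j)"
proof -
  have KK: "ideal_prod R (K i) (K j) = K (i + j)" for i j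
  proof (induction j)
    case 0 then show ?case using ideal_K[of i] by (simp add: ideal_power_simps ideal_prod_one)
  next
    case (Suc j)
    then show ?case
      using ideal_prod_assoc[OF ideal_K ideal_K ideal_I, of i j] by (simp add: ideal_power_simps)
  qed
  show "a \<in> K i \<Longrightarrow> b \<in> K j \<Longrightarrow> a * b \<in> K (i + j)"
    using ideal_prod.prod[of a "K i" b "K j" R] by (simp add: KK)
  show "a \<in> J i \<Longrightarrow> b \<in> K j \<Longrightarrow> a * b \<in> J (i + j)"
    using ideal_prod.prod[of a "J i" b "K j" R] ideal_prod_assoc[OF ideal_M ideal_K ideal_K, of i j]
    by (simp add: KK)
qed

lemma coset_eq:
  assumes "a - b \<in> J k" "b \<in> carrier R"
  shows "J k +>\<^bsub>R\<^esub> a = J k +>\<^bsub>R\<^esub> b"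
proof -
  interpret J: ideal "J k" R by (rule ideal_J)
  have "a \<in> J k +>\<^bsub>R\<^esub> b" using assms by (force simp: a_r_coset_def r_coset_def)
  then show ?thesis using a_repr_independence[OF _ assms(2) J.a_subgroup] by metis
qed

text \<open>\<open>rcoset_mult\<close> is a union over all pairs of representatives, so they must
  all give the same coset. Two products differ by \<open>x * b' + y * a\<close> with
  \<open>x \<in> J i\<close> and \<open>y \<in> J j\<close>, which lies in
  \<open>J (i + j)\<close>.\<close>

lemma rcoset_mult_J:
  assumes a: "a \<in> K i" and b: "b \<in> K j"
  shows "rcoset_mult R (J (i + j)) (J i +>\<^bsub>R\<^esub> a) (J j +>\<^bsub>R\<^esub> b) = J (i + j) +>\<^bsub>R\<^esub> (a * b)"
proof -
  have "J (i + j) +>\<^bsub>R\<^esub> (a' * b') = J (i + j) +>\<^bsub>R\<^esub> (a * b)"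
    if a': "a' \<in> J i +>\<^bsub>R\<^esub> a" and b': "b' \<in> J j +>\<^bsub>R\<^esub> b" for a' b'
  proof (rule coset_eq)
    obtain x y where x: "x \<in> J i" "a' = x + a" and y: "y \<in> J j" "b' = y + b"
      using a' b' by (auto simp: a_r_coset_def r_coset_def)
    have "b' \<in> K j"
      unfolding y(2) using y(1) ideal_prod_inter[OF ideal_M ideal_K] b
      by (blast intro: ideal_mpoly_ringD(2)[OF ideal_K])
    then have "x * b' \<in> J (i + j)" by (rule J_mult[OF x(1)])
    moreover have "y * a \<in> J (i + j)" using J_mult[OF y(1) a] unfolding add.commute[of j i] .
    ultimately have "x * b' + y * a \<in> J (i + j)" by (rule ideal_mpoly_ringD(2)[OF ideal_J])
    then show "a' * b' - a * b \<in> J (i + j)" by (simp add: x y algebra_simps)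
    show "a * b \<in> carrier R" using K_mult[OF a b] by (rule ideal_mpoly_ringD(3)[OF ideal_K])
  qed
  moreover have "a \<in> J i +>\<^bsub>R\<^esub> a" "b \<in> J j +>\<^bsub>R\<^esub> b"
    using ideal_mpoly_ringD(1)[OF ideal_J]
    by (auto simp: a_r_coset_def r_coset_def intro!: bexI[of _ 0])
  ultimately show ?thesis unfolding rcoset_mult_def mpoly_ring_simps by blast
qed

lemma finsum_Quot:
  assumes "\<And>i. i \<in> S \<Longrightarrow> g i \<in> carrier R" "finite S"
  shows "finsum (R Quot J n) (\<lambda>i. J n +>\<^bsub>R\<^esub> g i) S = J n +>\<^bsub>R\<^esub> (\<Sum>i\<in>S. g i)"
proof -
  interpret Jn: ideal "J n" R by (rule ideal_J)
  interpret Q: ring_hom_ring R "R Quot J n" "(+>\<^bsub>R\<^esub>) (J n)" by (rule Jn.rcos_ring_hom_ring)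
  have "finsum R g S = (\<Sum>i\<in>S. g i)"
    using assms(2,1) by (induction S rule: finite_induct) (simp_all add: finsum_insert Pi_iff)
  moreover have "g \<in> S \<rightarrow> carrier R" using assms by blast
  ultimately show ?thesis using Q.hom_finsum[of g S] by (simp add: comp_def)
qed

definition to_fiber :: "(('x \<Rightarrow>\<^sub>0 nat) \<Rightarrow>\<^sub>0 'a) poly \<Rightarrow> nat \<Rightarrow> (('x \<Rightarrow>\<^sub>0 nat) \<Rightarrow>\<^sub>0 'a) set" where
  "to_fiber q k = J k +>\<^bsub>R\<^esub> Polynomial.coeff q k"

lemma coset_zero: "J k +>\<^bsub>R\<^esub> 0 = J k"
  using a_coset_add_zero[of "J k"] ideal_J[of k]
  by (simp add: additive_subgroup.a_subset ideal.axioms(1))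

lemma rees_K: "q \<in> rees F \<Longrightarrow> Polynomial.coeff q k \<in> K k"
  by (simp add: rees_def form_K)

lemma rees_carrier: "q \<in> rees F \<Longrightarrow> Polynomial.coeff q k \<in> carrier R"
  using rees_K ideal_mpoly_ringD(3)[OF ideal_K] by blast

lemma to_fiber_closed: "q \<in> rees F \<Longrightarrow> to_fiber q \<in> carrier A"
proof -
  assume q: "q \<in> rees F"
  have "{k. to_fiber q k \<noteq> J k} \<subseteq> {..Polynomial.degree q}"
    by (auto simp: to_fiber_def coset_zero intro!: le_degree)
  then have "finite {k. to_fiber q k \<noteq> J k}" by (rule finite_subset) simp
  then show ?thesis
    using rees_K[OF q] by (auto simp: special_fiber_ring_def Let_def to_fiber_def)
qed

lemma to_fiber_one: "to_fiber 1 = \<one>\<^bsub>A\<^esub>"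
  by (rule ext) (simp add: special_fiber_ring_def Let_def to_fiber_def coset_zero)

lemma to_fiber_zero: "to_fiber 0 = \<zero>\<^bsub>A\<^esub>"
  by (rule ext) (simp add: special_fiber_ring_def Let_def to_fiber_def coset_zero)

lemma to_fiber_add:
  assumes "p \<in> rees F" "q \<in> rees F"
  shows "to_fiber (p + q) = to_fiber p \<oplus>\<^bsub>A\<^esub> to_fiber q"
proof
  fix k
  interpret ideal "J k" R by (rule ideal_J)
  show "to_fiber (p + q) k = (to_fiber p \<oplus>\<^bsub>A\<^esub> to_fiber q) k"
    using a_rcos_sum[OF assms[THEN rees_carrier]]
    by (simp add: special_fiber_ring_def Let_def to_fiber_def)
qed

lemma to_fiber_mult:
  assumes "p \<in> rees F" "q \<in> rees F"
  shows "to_fiber (p * q) = to_fiber p \<otimes>\<^bsub>A\<^esub> to_fiber q"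
proof
  fix n
  interpret J: ideal "J n" R by (rule ideal_J)
  interpret Q: ring "R Quot J n" by (rule J.quotient_is_ring)
  have 1: "rcoset_mult R (J n) (to_fiber p i) (to_fiber q (n - i)) =
      J n +>\<^bsub>R\<^esub> (Polynomial.coeff p i * Polynomial.coeff q (n - i))" if "i \<le> n" for i
    using rcoset_mult_J[OF rees_K[OF assms(1), of i] rees_K[OF assms(2), of "n - i"]] that
    by (simp add: to_fiber_def)
  have 2: "Polynomial.coeff p i * Polynomial.coeff q (n - i) \<in> carrier R" for i
    using m_closed[OF rees_carrier[OF assms(1)] rees_carrier[OF assms(2)]] by simp
  have 3: "J n +>\<^bsub>R\<^esub> (Polynomial.coeff p i * Polynomial.coeff q (n - i)) \<in> carrier (R Quot J n)" for i
    using 2[of i] by (auto simp: FactRing_def A_RCOSETS_defs a_r_coset_def)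
  have "(to_fiber p \<otimes>\<^bsub>A\<^esub> to_fiber q) n =
      finsum (R Quot J n) (\<lambda>i. rcoset_mult R (J n) (to_fiber p i) (to_fiber q (n - i))) {..n}"
    by (simp add: special_fiber_ring_def Let_def)
  also have "\<dots> = finsum (R Quot J n)
      (\<lambda>i. J n +>\<^bsub>R\<^esub> (Polynomial.coeff p i * Polynomial.coeff q (n - i))) {..n}"
    by (rule Q.finsum_cong') (use 1 3 in auto)
  also have "\<dots> = J n +>\<^bsub>R\<^esub> (\<Sum>i\<le>n. Polynomial.coeff p i * Polynomial.coeff q (n - i))"
    by (rule finsum_Quot[OF 2]) simp
  finally show "to_fiber (p * q) n = (to_fiber p \<otimes>\<^bsub>A\<^esub> to_fiber q) n"
    by (simp add: to_fiber_def Polynomial.coeff_mult)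
qed

lemma to_fiber_surj:
  assumes "c \<in> carrier A"
  shows "\<exists>q\<in>rees F. to_fiber q = c"
proof -
  have c: "\<forall>k. \<exists>a\<in>K k. c k = J k +>\<^bsub>R\<^esub> a" "finite {k. c k \<noteq> J k}"
    using assms by (auto simp: special_fiber_ring_def Let_def)
  \<comment> \<open>The last conjunct gives the chosen representatives finite support, so that they
    are the coefficients of a polynomial.\<close>
  have "\<exists>v. form F k v \<and> c k = J k +>\<^bsub>R\<^esub> v \<and> (c k = J k \<longrightarrow> v = 0)" for k
  proof (cases "c k = J k")
    case True then show ?thesis using coset_zero form.zero by metis
  next
    case False
    obtain a where a: "a \<in> K k" "c k = J k +>\<^bsub>R\<^esub> a" using c(1) by blast
    obtain v where v: "form F k v" "a - v \<in> J k" using K_decompose[OF a(1)] by blast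
    then show ?thesis
      using coset_eq[OF v(2)] form_K[OF v(1)] ideal_mpoly_ringD(3)[OF ideal_K] a False by blast
  qed
  then obtain v where v: "\<And>k. form F k (v k)" "\<And>k. c k = J k +>\<^bsub>R\<^esub> v k" "\<And>k. c k = J k \<Longrightarrow> v k = 0"
    by metis
  have "finite {k. v k \<noteq> 0}" using c(2) by (rule finite_subset[rotated]) (use v(3) in auto)
  then have "\<forall>\<^sub>\<infinity>k. v k = 0" by (simp add: eventually_cofinite)
  then have "Polynomial.coeff (Abs_poly v) = v" by (rule poly.Abs_poly_inverse[OF CollectI])
  then show ?thesis
    using v by (intro bexI[of _ "Abs_poly v"]) (auto simp: rees_def to_fiber_def fun_eq_iff)
qed

end

text \<open>The primes pull back along the surjection \<open>to_fiber\<close> to a strict chain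
  \<open>Q i\<close> in \<open>rees F\<close>. Elements \<open>x i\<close> of the successive
  differences satisfy no relation modulo \<open>Q 0\<close>, hence none at all. Setting the Rees
  variable to 1 and applying \<open>scale\<close> are injective on \<open>rees F\<close>, so the
  images of the \<open>x i\<close>, which lie in the algebra generated by \<open>Z\<close>, remain
  independent.\<close>

lemma (in fiber) analytic_spread_le:
  assumes Z: "finite Z" and hom: "\<And>f. f \<in> F \<Longrightarrow> homogeneous d f" "d > 0"
    and alg: "\<And>f. f \<in> F \<Longrightarrow> alg Z (scale x0 N f)" and x0: "x0 \<notin> N"
  shows "analytic_spread R M I \<le> card Z"
  unfolding analytic_spread_def krull_dim_def
proof (rule Sup_least, clarify)
  fix n P
  assume P: "\<forall>i\<le>n. primeideal (P i) A" and chain: "\<forall>i<n. P i \<subset> P (Suc i)"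
  define Q where "Q i = {q \<in> rees F. to_fiber q \<in> P i}" for i
  have ideal: "ideal (P i) A" if "i \<le> n" for i using P that primeideal.axioms(1) by blast
  have "\<exists>q\<in>rees F. to_fiber q \<in> P (Suc i) \<and> to_fiber q \<notin> P i" if "i < n" for i
  proof -
    obtain c where c: "c \<in> P (Suc i)" "c \<notin> P i" using chain \<open>i < n\<close> by blast
    have "c \<in> carrier A" using ideal.Icarr[OF ideal c(1)] \<open>i < n\<close> by simp
    then show ?thesis using to_fiber_surj c by blast
  qed
  then obtain x where x: "\<And>i. i < n \<Longrightarrow> x i \<in> rees F" "\<And>i. i < n \<Longrightarrow> x i \<in> Q (Suc i)"
      "\<And>i. i < n \<Longrightarrow> x i \<notin> Q i"
    unfolding Q_def by (metis (no_types, lifting) mem_Collect_eq)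
  have rees_uminus_1: "- 1 \<in> rees F" and rees_0: "0 \<in> rees F" and rees_1: "1 \<in> rees F"
    using rees_const[of "- 1" F] rees_const[of 0 F] rees_const[of 1 F]
    by (simp_all add: single_uminus one_pCons)
  have indep: "(\<Sum>e\<in>E. [:cst (c e):] * (\<Prod>i\<in>{0..<n}. x i ^ e i)) \<notin> Q 0"
    if "finite E" "E \<noteq> {}" "\<And>e. e \<in> E \<Longrightarrow> c e \<noteq> 0"
      "\<And>e e'. e \<in> E \<Longrightarrow> e' \<in> E \<Longrightarrow> (\<And>i. i \<in> {0..<n} \<Longrightarrow> e i = e' i) \<Longrightarrow> e = e'"
    for E and c :: "_ \<Rightarrow> 'a"
  proof (rule prime_chain_monomials[where B = "rees F" and Q = Q and \<iota> = "\<lambda>c. [:cst c:]" and n = n])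
    fix i a b assume i: "i \<le> n"
    interpret Pi: primeideal "P i" A using P i by blast
    show "Q i \<subseteq> rees F" by (auto simp: Q_def)
    show "1 \<notin> Q i"
      using Pi.one_imp_carrier Pi.I_notcarr by (auto simp: Q_def to_fiber_one)
    show "a + b \<in> Q i" if "a \<in> Q i" "b \<in> Q i"
      using that Pi.a_closed by (auto simp: Q_def to_fiber_add rees_add)
    show "a * b \<in> Q i" if "a \<in> Q i" "b \<in> rees F"
      using that Pi.I_r_closed by (auto simp: Q_def to_fiber_mult rees_mult to_fiber_closed)
    show "a \<in> Q i \<or> b \<in> Q i" if "a \<in> rees F" "b \<in> rees F" "a * b \<in> Q i"
      using that Pi.I_prime[of "to_fiber a" "to_fiber b"]
      by (auto simp: Q_def to_fiber_mult to_fiber_closed)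
  next
    show "[:cst (c * d):] = [:cst c:] * [:cst d:]" for c d :: 'a
      by (simp add: mult_single mult.commute)
    show "Q i \<subseteq> Q (Suc i)" if "i < n" for i using chain that by (auto simp: Q_def)
  qed (use that x rees_0 rees_1 rees_uminus_1 in
      \<open>auto simp: rees_const rees_add rees_mult one_pCons\<close>)
  have "n \<le> card Z"
  proof (rule alg_card_bound[OF Z, of n "\<lambda>i. scale x0 N (poly (x i) 1)"])
    fix i assume "i < n"
    have "alg Z (scale x0 N (Polynomial.coeff (x i) k))" for k
      using x(1)[OF \<open>i < n\<close>] by (intro form_alg_scale[OF alg]) (auto simp: rees_def)
    then have "alg Z (\<Sum>k\<in>S. scale x0 N (Polynomial.coeff (x i) k))" for S
      by (induction S rule: infinite_finite_induct) (auto simp: alg_zero intro: alg.add)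
    then show "alg Z (scale x0 N (poly (x i) 1))" by (simp add: poly_altdef scale_sum)
  next
    fix E and c :: "(nat \<Rightarrow> nat) \<Rightarrow> 'a"
    assume E: "finite E" "E \<subseteq> {..<n} \<rightarrow>\<^sub>E UNIV"
      and sum: "(\<Sum>e\<in>E. cst (c e) * (\<Prod>i<n. scale x0 N (poly (x i) 1) ^ e i)) = 0"
    \<comment> \<open>\<open>indep\<close> asks for nonzero coefficients, so the vanishing terms are
      dropped.\<close>
    define E' where "E' = {e\<in>E. c e \<noteq> 0}"
    define q where "q = (\<Sum>e\<in>E'. [:cst (c e):] * (\<Prod>i\<in>{0..<n}. x i ^ e i))"
    have xpow: "x i ^ k \<in> rees F" if "i < n" for i k
      by (induction k) (auto simp: rees_1 rees_mult x(1)[OF that])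
    have "(\<Prod>i\<in>S. x i ^ e i) \<in> rees F" if "S \<subseteq> {0..<n}" for S and e :: "nat \<Rightarrow> nat"
      using that by (induction S rule: infinite_finite_induct) (auto simp: rees_1 rees_mult xpow)
    then have term_rees: "[:cst (c e):] * (\<Prod>i\<in>{0..<n}. x i ^ e i) \<in> rees F" for e
      by (blast intro: rees_mult rees_const)
    have "(\<Sum>e\<in>S. h e) \<in> rees F" if "\<And>e. h e \<in> rees F"
      for S and h :: "(nat \<Rightarrow> nat) \<Rightarrow> _"
      using that by (induction S rule: infinite_finite_induct) (auto simp: rees_0 rees_add)
    then have q: "q \<in> rees F" unfolding q_def using term_rees .
    have "scale x0 N (poly q 1) =
        (\<Sum>e\<in>E'. cst (c e) * (\<Prod>i<n. scale x0 N (poly (x i) 1) ^ e i))"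
      by (simp add: q_def poly_sum poly_prod scale_sum scale_mult scale_prod scale_power
          atLeast0LessThan)
    also have "\<dots> = 0"
      unfolding sum[symmetric] E'_def using E(1) by (intro sum.mono_neutral_left) auto
    \<comment> \<open>The relation lifts back along the two injective maps. Now \<open>q = 0\<close>
      lies in \<open>Q 0\<close>, which \<open>indep\<close> permits only for the empty sum.\<close>
    finally have "q = 0" using scale_eq_0[OF x0] rees_poly_1_eq_0[OF hom q] by blast
    moreover have "0 \<in> Q 0"
      using additive_subgroup.zero_closed[OF ideal.axioms(1)[OF ideal[of 0]]] rees_0
      by (simp add: Q_def to_fiber_zero)
    ultimately have "q \<in> Q 0" by simp
    have "E' = {}"
    proof (rule ccontr)
      assume "E' \<noteq> {}"
      have "q \<notin> Q 0"
        unfolding q_def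
      proof (rule indep)
        fix e e' assume e: "e \<in> E'" "e' \<in> E'" and eq: "\<And>i. i \<in> {0..<n} \<Longrightarrow> e i = e' i"
        then have "e \<in> {..<n} \<rightarrow>\<^sub>E UNIV" "e' \<in> {..<n} \<rightarrow>\<^sub>E UNIV" using E(2) by (auto simp: E'_def)
        then show "e = e'" by (rule PiE_ext) (use eq in auto)
      qed (use E \<open>E' \<noteq> {}\<close> in \<open>auto simp: E'_def\<close>)
      with \<open>q \<in> Q 0\<close> show False by simp
    qed
    then show "\<forall>e\<in>E. c e = 0" by (auto simp: E'_def)
  qed
  then show "enat n \<le> enat (card Z)" by simp
qed

section \<open>Dependent binomials\<close>

definition minor :: "('p \<Rightarrow> 'q \<Rightarrow> 'x) \<Rightarrow> 'p \<Rightarrow> 'p \<Rightarrow> 'q \<Rightarrow> 'q \<Rightarrow> (('x \<Rightarrow>\<^sub>0 nat) \<Rightarrow>\<^sub>0 'a::field)" where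
  "minor v i j k l = mvar (v i k) * mvar (v j l) - mvar (v i l) * mvar (v j k)"

lemma minor_swap:
  "minor v j i k l = - minor v i j k l" "minor v i j l k = - minor v i j k l"
  by (simp_all add: minor_def mult.commute)

lemma minor_transpose: "minor (\<lambda>k i. v i k) k l i j = minor v i j k l"
  by (simp add: minor_def mult.commute)

lemma alg_uminus: "alg Z p \<Longrightarrow> alg Z (- p)"
  using alg_diff[OF alg_zero] by force

lemma scale_uminus: "scale x0 M (- p) = - scale x0 M p"
  using scale_diff[of x0 M 0 p] by simp

text \<open>After an injective substitution, fewer than \<open>card E1 * card E2\<close> elements generate all
  the binomials belonging to \<open>E1\<close> and \<open>E2\<close>; hence these binomials are algebraically dependent.
  The argument \<open>v\<close> names the variables, which makes the notion symmetric in the two edge sets.\<close>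

definition dependent_minors ::
    "'a::field itself \<Rightarrow> ('p \<Rightarrow> 'q \<Rightarrow> 'x) \<Rightarrow> 'p set set \<Rightarrow> 'q set set \<Rightarrow> bool" where
  "dependent_minors _ v E1 E2 \<longleftrightarrow>
     (\<exists>x0 N (Y :: (('x \<Rightarrow>\<^sub>0 nat) \<Rightarrow>\<^sub>0 'a) set). x0 \<notin> N \<and> finite Y \<and> card Y < card E1 * card E2 \<and>
       (\<forall>i j k l. {i, j} \<in> E1 \<longrightarrow> {k, l} \<in> E2 \<longrightarrow> alg Y (scale x0 N (minor v i j k l))))"

lemma dependent_minorsI:
  fixes Y :: "(('x \<Rightarrow>\<^sub>0 nat) \<Rightarrow>\<^sub>0 'a::field) set"
  assumes "x0 \<notin> N" "finite Y" "card Y < card E1 * card E2"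
    "\<And>i j k l. {i, j} \<in> E1 \<Longrightarrow> {k, l} \<in> E2 \<Longrightarrow> alg Y (scale x0 N (minor v i j k l))"
  shows "dependent_minors TYPE('a) v E1 E2"
  unfolding dependent_minors_def using assms by blast

lemma dependent_minors_swap:
  fixes v :: "'p \<Rightarrow> 'q \<Rightarrow> 'x"
  assumes "dependent_minors TYPE('a::field) v E1 E2"
  shows "dependent_minors TYPE('a) (\<lambda>k i. v i k) E2 E1"
proof -
  obtain x0 N and Y :: "(('x \<Rightarrow>\<^sub>0 nat) \<Rightarrow>\<^sub>0 'a) set" where Y: "x0 \<notin> N" "finite Y"
      "card Y < card E1 * card E2"
      "\<And>i j k l. {i, j} \<in> E1 \<Longrightarrow> {k, l} \<in> E2 \<Longrightarrow> alg Y (scale x0 N (minor v i j k l))"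
    using assms unfolding dependent_minors_def by blast
  show ?thesis
  proof (rule dependent_minorsI[OF Y(1,2)])
    show "card Y < card E2 * card E1" using Y(3) by (simp only: mult.commute)
    show "alg Y (scale x0 N (minor (\<lambda>k i. v i k) k l i j))" if "{k, l} \<in> E2" "{i, j} \<in> E1" for i j k l
      unfolding minor_transpose[of v] by (rule Y(4)[OF that(2,1)])
  qed
qed

text \<open>Normalise the entry of the centre row in column \<open>b0\<close> to 1 and clear column
  \<open>b0\<close> in every leaf row, which does not affect minors with the centre row. What
  remains are \<open>(card L + 1) * (card B - 1)\<close> entries, fewer than
  \<open>card L * card B\<close> exactly when \<open>card B \<le> card L\<close>.\<close>

lemma dependent_minors_star:
  fixes v :: "'p \<Rightarrow> 'q \<Rightarrow> 'x"
  assumes v: "\<And>i k i' k'. v i k = v i' k' \<longleftrightarrow> i = i' \<and> k = k'"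
    and L: "finite L" "a0 \<notin> L" and B: "finite B" "b0 \<in> B" and E2: "E2 \<subseteq> Pow B" "card B \<le> card E2"
    and le: "card B \<le> card L"
  shows "dependent_minors TYPE('a::field) v ((\<lambda>a. {a0, a}) ` L) E2"
proof -
  let ?x = "\<lambda>a c. mvar (v a c) :: ('x \<Rightarrow>\<^sub>0 nat) \<Rightarrow>\<^sub>0 'a"
  define N where "N = {v a0 c |c. c \<noteq> b0}"
  \<comment> \<open>\<open>r\<close> is the centre row divided by its entry in column
    \<open>b0\<close>, written after the substitution. The factor \<open>?x a0 b0\<close> that this
    takes out of the centre row is moved into the cleared leaf rows \<open>w\<close>.\<close>
  define r where "r c = (if c = b0 then 1 else ?x a0 c)" for c
  define w where "w a c = ?x a0 b0 * (?x a c - ?x a b0 * r c)" for a c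
  define Y where "Y = r ` (B - {b0}) \<union> (\<lambda>(a, c). w a c) ` (L \<times> (B - {b0}))"
  have scale0: "scale (v a0 b0) N (?x a0 c) = ?x a0 b0 * r c" for c
    by (auto simp: scale_mvar N_def r_def v)
  have scale: "scale (v a0 b0) N (?x a c) = ?x a c" if "a \<in> L" for a c
    using that L by (auto simp: scale_mvar N_def v)
  have r: "alg Y (r c)" if "c \<in> B" for c
    using that by (cases "c = b0") (auto simp: r_def[of b0] alg_one Y_def intro!: alg.gen)
  have w: "alg Y (w a c)" if "a \<in> L" "c \<in> B" for a c
  proof (cases "c = b0")
    case True then show ?thesis by (simp add: w_def r_def alg_zero)
  next
    case False
    then have "w a c \<in> Y" using that unfolding Y_def by force
    then show ?thesis by (rule alg.gen)
  qed
  have main: "alg Y (scale (v a0 b0) N (minor v a0 a c d))" if "a \<in> L" "c \<in> B" "d \<in> B" for a c d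
  proof -
    have "scale (v a0 b0) N (minor v a0 a c d) = r c * w a d - r d * w a c"
      using that(1) by (simp add: minor_def scale_diff scale_mult scale0 scale w_def algebra_simps)
    then show ?thesis using that by (simp add: alg_diff alg.mult r w)
  qed
  show ?thesis
  proof (rule dependent_minorsI)
    show "v a0 b0 \<notin> N" by (auto simp: N_def v)
    show "finite Y" using L B by (simp add: Y_def)
    have "card Y \<le> card (B - {b0}) + card (L \<times> (B - {b0}))"
      unfolding Y_def using L B
      by (intro order_trans[OF card_Un_le] add_mono card_image_le) auto
    also have "\<dots> = (card L + 1) * (card B - 1)"
      using B by (simp add: card_cartesian_product)
    also have "\<dots> < card L * card B"
    proof -
      obtain b where "card B = Suc b" using B by (cases "card B") auto
      then show ?thesis using le by (simp add: algebra_simps)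
    qed
    also have "card L = card ((\<lambda>a. {a0, a}) ` L)"
      using L by (intro card_image[symmetric] inj_onI) (auto simp: doubleton_eq_iff)
    finally show "card Y < card ((\<lambda>a. {a0, a}) ` L) * card E2"
      using E2(2) by (meson less_le_trans mult_le_mono2)
  next
    fix i j k l assume ij: "{i, j} \<in> (\<lambda>a. {a0, a}) ` L" and "{k, l} \<in> E2"
    then have kl: "k \<in> B" "l \<in> B" using E2 by auto
    from ij consider "i = a0" "j \<in> L" | "j = a0" "i \<in> L" by (auto simp: doubleton_eq_iff)
    then show "alg Y (scale (v a0 b0) N (minor v i j k l))"
    proof cases
      case 1 then show ?thesis using main kl by simp
    next
      case 2
      then show ?thesis using main[of i k l] kl
        by (subst minor_swap(1)) (simp add: scale_uminus alg_uminus)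
    qed
  qed
qed

text \<open>The binomials are invariant under scaling the variables in the rows \<open>V0\<close> by \<open>t\<close> and those
  in the rows \<open>V1\<close> by \<open>1/t\<close>, and this allows one variable to be normalised to 1.\<close>

lemma dependent_minors_bipartite:
  fixes v :: "'p \<Rightarrow> 'q \<Rightarrow> 'x"
  assumes v: "\<And>i k i' k'. v i k = v i' k' \<longleftrightarrow> i = i' \<and> k = k'"
    and V: "finite V0" "finite V1" "V0 \<inter> V1 = {}" "a0 \<in> V0"
    and E1: "\<And>e. e \<in> E1 \<Longrightarrow> \<exists>i\<in>V0. \<exists>j\<in>V1. e = {i, j}" "card (V0 \<union> V1) \<le> card E1"
    and B: "finite B" "b0 \<in> B" and E2: "E2 \<subseteq> Pow B" "card B \<le> card E2"
  shows "dependent_minors TYPE('a::field) v E1 E2"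
proof -
  let ?x = "\<lambda>a c. mvar (v a c) :: ('x \<Rightarrow>\<^sub>0 nat) \<Rightarrow>\<^sub>0 'a"
  define N where "N = {v a b |a b. a \<in> V0 \<and> \<not> (a = a0 \<and> b = b0)}"
  \<comment> \<open>The substitution turns the rows \<open>V0\<close> into \<open>?x a0 b0\<close>
    times \<open>y\<close> and leaves the rows \<open>V1\<close> alone, so the factor is moved into
    \<open>y\<close> on \<open>V1\<close>: the group element \<open>t\<close> is the entry
    \<open>?x a0 b0\<close> itself.\<close>
  define y where "y a b = (if a = a0 \<and> b = b0 then 1 else if a \<in> V0 then ?x a b else ?x a0 b0 * ?x a b)"
    for a b
  define Y where "Y = (\<lambda>(a, b). y a b) ` ((V0 \<union> V1) \<times> B - {(a0, b0)})"
  have y: "alg Y (y a b)" if "a \<in> V0 \<union> V1" "b \<in> B" for a b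
  proof (cases "a = a0 \<and> b = b0")
    case True then show ?thesis by (simp add: y_def alg_one)
  next
    case False
    then have "y a b \<in> Y" using that unfolding Y_def by force
    then show ?thesis by (rule alg.gen)
  qed
  have main: "alg Y (scale (v a0 b0) N (minor v i j k l))"
    if "i \<in> V0" "j \<in> V1" "k \<in> B" "l \<in> B" for i j k l
  proof -
    have "i \<noteq> j" "j \<notin> V0" "j \<noteq> a0" using that V by auto
    then have "scale (v a0 b0) N (?x i k) * scale (v a0 b0) N (?x j l) = y i k * y j l" for k l
      using \<open>i \<in> V0\<close> by (auto simp: scale_mvar N_def y_def v mult_ac)
    then have "scale (v a0 b0) N (minor v i j k l) = y i k * y j l - y i l * y j k"
      by (simp add: minor_def scale_diff scale_mult)
    then show ?thesis using that by (simp add: alg_diff alg.mult y)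
  qed
  show ?thesis
  proof (rule dependent_minorsI)
    show "v a0 b0 \<notin> N" by (auto simp: N_def v)
    have fin: "finite ((V0 \<union> V1) \<times> B)" using V B by simp
    then show "finite Y" by (simp add: Y_def)
    have "card Y \<le> card ((V0 \<union> V1) \<times> B - {(a0, b0)})"
      unfolding Y_def using fin by (intro card_image_le) simp
    \<comment> \<open>The normalised entry \<open>(a0, b0)\<close> is the one generator
      saved.\<close>
    also have "\<dots> < card ((V0 \<union> V1) \<times> B)"
      using fin V B by (intro psubset_card_mono) auto
    also have "\<dots> \<le> card E1 * card E2"
      unfolding card_cartesian_product using E1 E2 by (intro mult_le_mono)
    finally show "card Y < card E1 * card E2" .
  next
    fix i j k l assume ij: "{i, j} \<in> E1" and "{k, l} \<in> E2"
    then have kl: "k \<in> B" "l \<in> B" using E2 by auto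
    from E1(1)[OF ij] consider "i \<in> V0" "j \<in> V1" | "j \<in> V0" "i \<in> V1"
      by (auto simp: doubleton_eq_iff)
    then show "alg Y (scale (v a0 b0) N (minor v i j k l))"
    proof cases
      case 1 then show ?thesis using main kl by simp
    next
      case 2
      then show ?thesis using main[of j i k l] kl
        by (subst minor_swap(1)) (simp add: scale_uminus alg_uminus)
    qed
  qed
qed

text \<open>The binomials are invariant under adding a multiple of column \<open>u\<close> to column \<open>w\<close>, and
  this allows one entry of column \<open>w\<close> to be normalised to 0.\<close>

lemma dependent_minors_leaf:
  fixes v :: "'p \<Rightarrow> 'q \<Rightarrow> 'x"
  assumes v: "\<And>i k i' k'. v i k = v i' k' \<longleftrightarrow> i = i' \<and> k = k'"
    and A: "finite A" "a0 \<in> A" and E1: "E1 \<subseteq> Pow A" "card A \<le> card E1"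
    and B: "finite B" "u \<in> B" "w \<notin> B" and E2: "E2 \<subseteq> Pow B" "card B \<le> card E2"
  shows "dependent_minors TYPE('a::field) v E1 (insert {u, w} E2)"
proof -
  let ?x = "\<lambda>a c. mvar (v a c) :: ('x \<Rightarrow>\<^sub>0 nat) \<Rightarrow>\<^sub>0 'a"
  define N where "N = {v a u |a. a \<noteq> a0}"
  \<comment> \<open>Column \<open>u\<close> divided by its entry in row \<open>a0\<close>, after the
    substitution.\<close>
  define r where "r a = (if a = a0 then 1 else ?x a u)" for a
  \<comment> \<open>Column \<open>w\<close> minus the multiple of column \<open>u\<close> that makes
    its entry in row \<open>a0\<close> vanish. Before the substitution the multiplier is the
    quotient of the entries \<open>(a0, w)\<close> and \<open>(a0, u)\<close>.\<close>
  define z where "z a = ?x a w - ?x a0 w * r a" for a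
  let ?s = "\<lambda>a b. scale (v a0 u) N (?x a b)"
  define Y where "Y = (\<lambda>(a, b). ?s a b) ` (A \<times> B) \<union> z ` (A - {a0})"
  have "u \<noteq> w" using B by auto
  have su: "?s a u = ?x a0 u * r a" for a by (auto simp: scale_mvar N_def r_def v)
  have sw: "?s a w = ?x a w" for a using \<open>u \<noteq> w\<close> by (auto simp: scale_mvar N_def v)
  have s: "alg Y (?s a b)" if "a \<in> A" "b \<in> B" for a b
    using that by (intro alg.gen) (auto simp: Y_def)
  have z: "alg Y (z a)" if "a \<in> A" for a
  proof (cases "a = a0")
    case True then show ?thesis by (simp add: z_def r_def alg_zero)
  next
    case False then show ?thesis using that by (intro alg.gen) (simp add: Y_def)
  qed
  have main: "alg Y (scale (v a0 u) N (minor v i j u w))" if "i \<in> A" "j \<in> A" for i j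
  proof -
    have "scale (v a0 u) N (minor v i j u w) = ?s i u * z j - z i * ?s j u"
      by (simp add: minor_def scale_diff scale_mult su sw z_def algebra_simps)
    then show ?thesis using that B by (simp add: alg_diff alg.mult s z)
  qed
  show ?thesis
  proof (rule dependent_minorsI)
    show "v a0 u \<notin> N" by (auto simp: N_def v)
    show "finite Y" using A B by (simp add: Y_def)
    have "card Y \<le> card (A \<times> B) + card (A - {a0})"
      unfolding Y_def using A B by (intro order_trans[OF card_Un_le] add_mono card_image_le) auto
    also have "\<dots> < card A * card B + card A"
      using card_Diff1_less[OF A] by (simp add: card_cartesian_product)
    also have "\<dots> = card A * Suc (card B)" by simp
    also have "\<dots> \<le> card E1 * Suc (card E2)" using E1 E2 by (intro mult_le_mono) auto
    also have "Suc (card E2) = card (insert {u, w} E2)"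
      using finite_subset[OF E2(1)] E2(1) B by (subst card_insert_disjoint) auto
    finally show "card Y < card E1 * card (insert {u, w} E2)" .
  next
    fix i j k l assume "{i, j} \<in> E1" and kl: "{k, l} \<in> insert {u, w} E2"
    then have ij: "i \<in> A" "j \<in> A" using E1 by auto
    from kl E2 consider "k = u" "l = w" | "k = w" "l = u" | "k \<in> B" "l \<in> B"
      by (auto simp: doubleton_eq_iff)
    then show "alg Y (scale (v a0 u) N (minor v i j k l))"
    proof cases
      case 1 then show ?thesis using main ij by simp
    next
      case 2
      then show ?thesis using main[of i j] ij
        by (subst minor_swap(2)) (simp add: scale_uminus alg_uminus)
    next
      case 3
      then show ?thesis using ij by (simp add: minor_def scale_diff scale_mult alg_diff alg.mult s)
    qed
  qed
qed

section \<open>Edge counts and bipartitions of cycles\<close>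

lemma edges_cycle_graph: "edges (cycle_graph k) = insert {1, k} ((\<lambda>i. {i, i + 1}) ` {1..<k})"
proof -
  have "{{i, i + 1} |i. 1 \<le> i \<and> i < k} = (\<lambda>i. {i, i + 1}) ` {1..<k}"
    unfolding setcompr_eq_image by (rule arg_cong[of _ _ "image _"]) auto
  then show ?thesis by (simp add: cycle_graph_def)
qed

text \<open>This is the source of the hypotheses \<open>card B \<le> card E2\<close> above. For
  \<open>k = 2\<close> the closing edge would coincide with \<open>{1, 2}\<close>.\<close>

lemma card_edges_cycle_graph:
  assumes "k \<ge> 3"
  shows "card (edges (cycle_graph k)) = k"
proof -
  have inj: "inj_on (\<lambda>i. {i, i + 1}) {1..<k}"
  proof (rule inj_onI)
    fix i j :: nat assume "{i, i + 1} = {j, j + 1}"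
    then show "i = j" unfolding doubleton_eq_iff by presburger
  qed
  have "{1, k} \<notin> (\<lambda>i. {i, i + 1}) ` {1..<k}"
  proof
    assume "{1, k} \<in> (\<lambda>i. {i, i + 1}) ` {1..<k}"
    then obtain i where "i \<in> {1..<k}" "{1, k} = {i, i + 1}" by blast
    then show False using assms unfolding doubleton_eq_iff by auto
  qed
  then have "card (edges (cycle_graph k)) = Suc (card ((\<lambda>i. {i, i + 1}) ` {1..<k}))"
    unfolding edges_cycle_graph by (intro card_insert_disjoint) simp
  then show ?thesis using assms by (simp only: card_image[OF inj] card_atLeastLessThan)
qed

lemma cycle_image:
  assumes k: "k \<ge> 3" and f: "inj_on f {1..k}"
  shows "(`) f ` edges (cycle_graph k) \<subseteq> Pow (f ` {1..k})"
    and "card ((`) f ` edges (cycle_graph k)) = card (f ` {1..k})"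
proof -
  have sub: "edges (cycle_graph k) \<subseteq> Pow {1..k}" using k by (auto simp: edges_cycle_graph)
  then show "(`) f ` edges (cycle_graph k) \<subseteq> Pow (f ` {1..k})"
    by (metis image_Pow_surj image_mono order_refl)
  have "inj_on ((`) f) (edges (cycle_graph k))"
    using inj_on_image_Pow[OF f] sub by (rule inj_on_subset)
  then show "card ((`) f ` edges (cycle_graph k)) = card (f ` {1..k})"
    using f k by (simp add: card_image card_edges_cycle_graph)
qed

text \<open>The parity of the labels is the bipartition; the closing edge \<open>{1, k}\<close>
  respects it because \<open>k\<close> is even.\<close>

lemma even_cycle_bipartite:
  assumes "even k" "k \<ge> 3" "e \<in> edges (cycle_graph k)"
  shows "\<exists>i\<in>{i\<in>{1..k}. odd i}. \<exists>j\<in>{j\<in>{1..k}. even j}. e = {i, j}"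
proof -
  from assms(3) consider "e = {1, k}" | i where "e = {i, i + 1}" "i \<in> {1..<k}"
    by (auto simp: edges_cycle_graph)
  then show ?thesis
  proof cases
    case 1
    have "1 \<in> {i\<in>{1..k}. odd i}" "k \<in> {j\<in>{1..k}. even j}" using assms(1,2) by simp_all
    with 1 show ?thesis by blast
  next
    case (2 i)
    then have mem: "i \<in> {1..k}" "i + 1 \<in> {1..k}" by simp_all
    show ?thesis
    proof (cases "even i")
      case True
      then have "i + 1 \<in> {i\<in>{1..k}. odd i}" "i \<in> {j\<in>{1..k}. even j}" using mem by simp_all
      moreover have "e = {i + 1, i}" using 2(1) by (simp add: insert_commute)
      ultimately show ?thesis by blast
    next
      case False
      then have "i \<in> {i\<in>{1..k}. odd i}" "i + 1 \<in> {j\<in>{1..k}. even j}" using mem by simp_all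
      with 2(1) show ?thesis by blast
    qed
  qed
qed

text \<open>Each pair of edges outside \<open>E1 \<times> E2\<close> contributes its own binomial as
  a generator, so the deficit of the chosen edge sets carries over to the whole graphs.\<close>

lemma analytic_spread_less:
  fixes G :: "'v::linorder sgraph" and H :: "'w::linorder sgraph"
  assumes G: "simple_graph G" and H: "simple_graph H"
    and E: "E1 \<subseteq> edges G" "E2 \<subseteq> edges H" and dep: "dependent_minors TYPE('a::field) Pair E1 E2"
  shows "analytic_spread (mpoly_ring (verts G \<times> verts H))
           (graded_maximal_ideal (verts G \<times> verts H))
           (pair_binomial_edge_ideal G H :: (('v \<times> 'w \<Rightarrow>\<^sub>0 nat) \<Rightarrow>\<^sub>0 'a) set)
         < enat (card (edges G) * card (edges H))"
proof -
  let ?X = "verts G \<times> verts H"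
  obtain x0 N and Y :: "(('v \<times> 'w \<Rightarrow>\<^sub>0 nat) \<Rightarrow>\<^sub>0 'a) set" where Y: "x0 \<notin> N" "finite Y"
      "card Y < card E1 * card E2"
      "\<And>i j k l. {i, j} \<in> E1 \<Longrightarrow> {k, l} \<in> E2 \<Longrightarrow> alg Y (scale x0 N (minor Pair i j k l))"
    using dep unfolding dependent_minors_def by blast
  define F :: "(('v \<times> 'w \<Rightarrow>\<^sub>0 nat) \<Rightarrow>\<^sub>0 'a) set" where
    "F = {mvar (i, k) * mvar (j, l) - mvar (i, l) * mvar (j, k) | i j k l.
          {i, j} \<in> edges G \<and> i < j \<and> {k, l} \<in> edges H \<and> k < l}"
  have FE: "\<exists>i j k l. f = minor Pair i j k l \<and> {i, j} \<in> edges G \<and> i < j \<and> {k, l} \<in> edges H \<and> k < l"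
    if "f \<in> F" for f using that by (auto simp: F_def minor_def)
  have mvar: "mvar x \<in> carrier (mpoly_ring ?X :: (('v \<times> 'w \<Rightarrow>\<^sub>0 nat) \<Rightarrow>\<^sub>0 'a) ring)" if "x \<in> ?X" for x
    using that by (auto simp: mpoly_ring_carrier mvar_def)
  interpret mp: cring "mpoly_ring ?X :: (('v \<times> 'w \<Rightarrow>\<^sub>0 nat) \<Rightarrow>\<^sub>0 'a) ring" by (rule cring_mpoly_ring)
  have "f \<in> carrier (mpoly_ring ?X)" if f: "f \<in> F" for f
  proof -
    obtain i j k l where *: "f = minor Pair i j k l" "{i, j} \<in> edges G" "{k, l} \<in> edges H"
      using FE[OF f] by blast
    have "{i, j} \<subseteq> verts G" "{k, l} \<subseteq> verts H"
      using G H *(2,3) by (auto simp: simple_graph_def)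
    then have X: "(i, k) \<in> ?X" "(j, l) \<in> ?X" "(i, l) \<in> ?X" "(j, k) \<in> ?X" by auto
    have "mvar (i, k) * mvar (j, l) \<in> carrier (mpoly_ring ?X :: (('v \<times> 'w \<Rightarrow>\<^sub>0 nat) \<Rightarrow>\<^sub>0 'a) ring)"
      "mvar (i, l) * mvar (j, k) \<in> carrier (mpoly_ring ?X :: (('v \<times> 'w \<Rightarrow>\<^sub>0 nat) \<Rightarrow>\<^sub>0 'a) ring)"
      using mp.m_closed[OF mvar[OF X(1)] mvar[OF X(2)]] mp.m_closed[OF mvar[OF X(3)] mvar[OF X(4)]]
      by simp_all
    then show ?thesis
      using keys_diff[of "mvar (i, k) * mvar (j, l)" "mvar (i, l) * mvar (j, k)"]
      unfolding *(1) minor_def mpoly_ring_carrier by blast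
  qed
  then interpret fiber ?X F by unfold_locales blast
  \<comment> \<open>\<open>Min\<close> and \<open>Max\<close> recover the ordered endpoints from an
    edge, so that the remaining generators are indexed by pairs of edges and can be counted.\<close>
  define g :: "'v set \<times> 'w set \<Rightarrow> (('v \<times> 'w \<Rightarrow>\<^sub>0 nat) \<Rightarrow>\<^sub>0 'a)"
    where "g = (\<lambda>(e, e'). scale x0 N (minor Pair (Min e) (Max e) (Min e') (Max e')))"
  let ?D = "edges G \<times> edges H - E1 \<times> E2"
  define Z where "Z = g ` ?D \<union> Y"
  have "edges G \<subseteq> Pow (verts G)" "edges H \<subseteq> Pow (verts H)"
    using G H by (auto simp: simple_graph_def)
  then have fin: "finite (edges G)" "finite (edges H)"
    using G H by (auto simp: simple_graph_def intro: finite_subset)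
  then have finE: "finite E1" "finite E2" using E by (auto intro: finite_subset)
  have "analytic_spread R M I \<le> card Z"
  proof (rule analytic_spread_le)
    show "finite Z" using fin Y(2) by (simp add: Z_def)
    show "homogeneous 2 f" if "f \<in> F" for f
      using FE[OF that] homogeneous_mult[OF homogeneous_mvar homogeneous_mvar]
      by (auto simp: minor_def numeral_2_eq_2 intro!: homogeneous_diff)
    fix f assume "f \<in> F"
    then obtain i j k l where f: "f = minor Pair i j k l" "{i, j} \<in> edges G" "i < j" "{k, l} \<in> edges H" "k < l"
      using FE by blast
    show "alg Z (scale x0 N f)"
    proof (cases "{i, j} \<in> E1 \<and> {k, l} \<in> E2")
      case True
      have "alg Y p \<Longrightarrow> alg Z p" for p by (induction rule: alg.induct) (auto simp: Z_def intro: alg.intros)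
      then show ?thesis using Y(4) True f(1) by blast
    next
      case False
      then have "g ({i, j}, {k, l}) \<in> Z" using f by (auto simp: Z_def)
      moreover have "g ({i, j}, {k, l}) = scale x0 N f" using f by (simp add: g_def)
      ultimately show ?thesis by (auto intro: alg.gen)
    qed
  qed (use Y in auto)
  moreover have "card Z < card (edges G) * card (edges H)"
  proof -
    have "card Z \<le> card ?D + card Y"
      unfolding Z_def using fin by (intro order_trans[OF card_Un_le] add_mono card_image_le) auto
    also have "\<dots> < card ?D + card (E1 \<times> E2)" using Y(3) by (simp add: card_cartesian_product)
    also have "\<dots> = card (edges G \<times> edges H)"
    proof -
      have sub: "E1 \<times> E2 \<subseteq> edges G \<times> edges H" using E by auto
      then have "card ?D = card (edges G \<times> edges H) - card (E1 \<times> E2)"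
        using finE by (intro card_Diff_subset) auto
      moreover have "card (E1 \<times> E2) \<le> card (edges G \<times> edges H)" using sub fin by (intro card_mono) auto
      ultimately show ?thesis by simp
    qed
    finally show ?thesis by (simp add: card_cartesian_product)
  qed
  moreover have "pair_binomial_edge_ideal G H = I" by (simp add: pair_binomial_edge_ideal_def F_def)
  ultimately show ?thesis by (simp add: le_less_trans[of _ "enat (card Z)"])
qed

section \<open>Vertex and edge sets of the contained subgraphs\<close>

lemma contains_graphE:
  assumes "contains_graph G H"
  obtains f where "inj_on f (verts H)" "(`) f ` edges H \<subseteq> edges G"
  using assms unfolding contains_graph_def by blast

lemma contains_cycleE:
  assumes "contains_graph G (cycle_graph k)" "k \<ge> 3"
  obtains B E b where "finite B" "card B = k" "b \<in> B" "E \<subseteq> edges G" "E \<subseteq> Pow B" "card B \<le> card E"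
proof -
  have verts: "verts (cycle_graph k) = {1..k}" by (simp add: cycle_graph_def)
  obtain f where f: "inj_on f {1..k}" "(`) f ` edges (cycle_graph k) \<subseteq> edges G"
    by (rule contains_graphE[OF assms(1), unfolded verts])
  show thesis
  proof (rule that[of "f ` {1..k}" "f 1" "(`) f ` edges (cycle_graph k)"])
    show "card (f ` {1..k}) = k" using f by (simp add: card_image)
  qed (use f(2) assms(2) cycle_image[OF assms(2) f(1)] in auto)
qed

lemma contains_even_cycleE:
  assumes "contains_graph G (cycle_graph k)" "k \<ge> 3" "even k"
  obtains V0 V1 E a where "finite V0" "finite V1" "V0 \<inter> V1 = {}" "a \<in> V0" "E \<subseteq> edges G"
    "\<forall>e\<in>E. \<exists>i\<in>V0. \<exists>j\<in>V1. e = {i, j}" "card (V0 \<union> V1) \<le> card E"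
proof -
  have verts: "verts (cycle_graph k) = {1..k}" by (simp add: cycle_graph_def)
  obtain f where f: "inj_on f {1..k}" "(`) f ` edges (cycle_graph k) \<subseteq> edges G"
    by (rule contains_graphE[OF assms(1), unfolded verts])
  let ?V0 = "{i\<in>{1..k}. odd i}" and ?V1 = "{i\<in>{1..k}. even i}"
  show thesis
  proof (rule that[of "f ` ?V0" "f ` ?V1" "f 1" "(`) f ` edges (cycle_graph k)"])
    have "f ` ?V0 \<inter> f ` ?V1 = f ` (?V0 \<inter> ?V1)"
      by (rule inj_on_image_Int[OF f(1), symmetric]) auto
    also have "?V0 \<inter> ?V1 = {}" by auto
    finally show "f ` ?V0 \<inter> f ` ?V1 = {}" by simp
    have "f ` ?V0 \<union> f ` ?V1 = f ` {1..k}" by auto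
    then show "card (f ` ?V0 \<union> f ` ?V1) \<le> card ((`) f ` edges (cycle_graph k))"
      using cycle_image(2)[OF assms(2) f(1)] by simp
    show "f 1 \<in> f ` ?V0" using assms(2) by (intro imageI) simp
    show "\<forall>e\<in>(`) f ` edges (cycle_graph k). \<exists>i\<in>f ` ?V0. \<exists>j\<in>f ` ?V1. e = {i, j}"
    proof
      fix e assume "e \<in> (`) f ` edges (cycle_graph k)"
      then obtain e' where e': "e' \<in> edges (cycle_graph k)" "e = f ` e'" by blast
      obtain i j where ij: "i \<in> ?V0" "j \<in> ?V1" "e' = {i, j}"
        using even_cycle_bipartite[OF assms(3,2) e'(1)] by blast
      then have "e = {f i, f j}" using e'(2) by simp
      then show "\<exists>i\<in>f ` ?V0. \<exists>j\<in>f ` ?V1. e = {i, j}" using ij(1,2) by blast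
    qed
  qed (use f(2) in simp_all)
qed

lemma contains_leafE:
  assumes "is_cycle_with_leaf L" "contains_graph H L"
  obtains B E u w where "finite B" "u \<in> B" "w \<notin> B" "insert {u, w} E \<subseteq> edges H" "E \<subseteq> Pow B"
    "card B \<le> card E"
proof -
  obtain k u v where k: "k \<ge> 3" and uv: "u \<in> verts (cycle_graph k)" "v \<notin> verts (cycle_graph k)"
    and L: "L = \<lparr>verts = insert v (verts (cycle_graph k)),
             edges = insert {u, v} (edges (cycle_graph k))\<rparr>"
    using assms(1) unfolding is_cycle_with_leaf_def by blast
  have vc: "verts (cycle_graph k) = {1..k}" by (simp add: cycle_graph_def)
  obtain f where f: "inj_on f (insert v {1..k})" "(`) f ` edges L \<subseteq> edges H"
    by (rule contains_graphE[OF assms(2)]) (simp add: L vc)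
  have inj: "inj_on f {1..k}" using f(1) by (rule inj_on_subset) auto
  show thesis
  proof (rule that[of "f ` {1..k}" "f u" "f v" "(`) f ` edges (cycle_graph k)"])
    show "f v \<notin> f ` {1..k}" using f(1) uv(2) vc by (auto simp: inj_on_def)
    show "insert {f u, f v} ((`) f ` edges (cycle_graph k)) \<subseteq> edges H" using f(2) by (simp add: L)
  qed (use uv(1) vc cycle_image[OF k inj] in simp_all)
qed

theorem theorem1p8:
  fixes G :: "'v::linorder sgraph" and H :: "'w::linorder sgraph"
  assumes "simple_graph G" and "connected_graph G" and "card (verts G) \<ge> 3"
    and "simple_graph H" and "connected_graph H" and "card (verts H) \<ge> 3"
    and "CHAR('a::field) = 0 \<or> CHAR('a) > 2 ^ (card (verts G) * card (verts H))"
    and "(\<exists>r\<ge>2. \<exists>k\<ge>3. r > k \<and> contains_graph G (star_graph r) \<and> contains_graph H (cycle_graph k))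
       \<or> (\<exists>k\<ge>3. \<exists>l\<ge>3. contains_graph G (cycle_graph k) \<and> contains_graph H (cycle_graph l) \<and>
            (even k \<or> even l))
       \<or> ((\<exists>k\<ge>3. contains_graph G (cycle_graph k)) \<and>
            (\<exists>L. is_cycle_with_leaf L \<and> contains_graph H L))
       \<or> ((\<exists>k\<ge>3. contains_graph H (cycle_graph k)) \<and>
            (\<exists>L. is_cycle_with_leaf L \<and> contains_graph G L))"
  shows "analytic_spread (mpoly_ring (verts G \<times> verts H))
           (graded_maximal_ideal (verts G \<times> verts H))
           (pair_binomial_edge_ideal G H :: (('v \<times> 'w \<Rightarrow>\<^sub>0 nat) \<Rightarrow>\<^sub>0 'a) set)
         < enat (card (edges G) * card (edges H))"
proof -
  from assms(8) have "\<exists>E1 E2. E1 \<subseteq> edges G \<and> E2 \<subseteq> edges H \<and> dependent_minors TYPE('a) Pair E1 E2"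
  proof (elim disjE exE conjE)
    fix r k assume r: "2 \<le> r" "k < r" and k: "3 \<le> k"
      and star: "contains_graph G (star_graph r)" and cyc: "contains_graph H (cycle_graph k)"
    obtain f where f: "inj_on f {1..r}" "(`) f ` edges (star_graph r) \<subseteq> edges G"
      by (rule contains_graphE[OF star]) (simp add: star_graph_def)
    obtain B E b where B: "finite B" "card B = k" "b \<in> B" "E \<subseteq> edges H" "E \<subseteq> Pow B" "card B \<le> card E"
      by (rule contains_cycleE[OF cyc k])
    \<comment> \<open>A star of order \<open>r\<close> has \<open>r - 1\<close> leaves, so
      \<open>k < r\<close> is precisely the inequality that the star case asks for.\<close>
    have "card (f ` {2..r}) = r - 1"
      using inj_on_subset[OF f(1), of "{2..r}"] by (simp add: card_image)
    moreover have "f 1 \<notin> f ` {2..r}" using inj_on_image_mem_iff[OF f(1), of 1 "{2..r}"] r by simp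
    ultimately have "dependent_minors TYPE('a) Pair ((\<lambda>a. {f 1, a}) ` (f ` {2..r})) E"
      using B r by (intro dependent_minors_star[of _ _ _ B b]) auto
    moreover have "(\<lambda>a. {f 1, a}) ` (f ` {2..r}) \<subseteq> edges G"
    proof clarify
      fix i assume "i \<in> {2..r}"
      then have "{1, i} \<in> edges (star_graph r)" by (auto simp: star_graph_def)
      then have "f ` {1, i} \<in> edges G" using f(2) by blast
      then show "{f 1, f i} \<in> edges G" by simp
    qed
    ultimately show ?thesis using B(4) by blast
  next
    fix k l assume k: "3 \<le> k" and l: "3 \<le> l" and cyc: "contains_graph G (cycle_graph k)"
      "contains_graph H (cycle_graph l)" and even: "even k"
    obtain V0 V1 E1 a where V: "finite V0" "finite V1" "V0 \<inter> V1 = {}" "a \<in> V0" and E1: "E1 \<subseteq> edges G"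
        "\<forall>e\<in>E1. \<exists>i\<in>V0. \<exists>j\<in>V1. e = {i, j}" "card (V0 \<union> V1) \<le> card E1"
      by (rule contains_even_cycleE[OF cyc(1) k even])
    obtain B E2 b where B: "finite B" "b \<in> B" "E2 \<subseteq> edges H" "E2 \<subseteq> Pow B" "card B \<le> card E2"
      by (rule contains_cycleE[OF cyc(2) l])
    have "dependent_minors TYPE('a) Pair E1 E2"
      by (rule dependent_minors_bipartite[OF _ V E1(2)[rule_format] E1(3) B(1,2,4,5)]) simp
    then show ?thesis using E1(1) B(3) by blast
  next
    fix k l assume k: "3 \<le> k" and l: "3 \<le> l" and cyc: "contains_graph G (cycle_graph k)"
      "contains_graph H (cycle_graph l)" and even: "even l"
    obtain V0 V1 E1 a where V: "finite V0" "finite V1" "V0 \<inter> V1 = {}" "a \<in> V0" and E1: "E1 \<subseteq> edges H"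
        "\<forall>e\<in>E1. \<exists>i\<in>V0. \<exists>j\<in>V1. e = {i, j}" "card (V0 \<union> V1) \<le> card E1"
      by (rule contains_even_cycleE[OF cyc(2) l even])
    obtain B E2 b where B: "finite B" "b \<in> B" "E2 \<subseteq> edges G" "E2 \<subseteq> Pow B" "card B \<le> card E2"
      by (rule contains_cycleE[OF cyc(1) k])
    \<comment> \<open>The even cycle lies in \<open>H\<close>, so the rows are now indexed by
      \<open>H\<close>. The naming function transposes the pairs, and the swap restores the
      order.\<close>
    have "dependent_minors TYPE('a) (\<lambda>k i. (i, k)) E1 E2"
      by (rule dependent_minors_bipartite[OF _ V E1(2)[rule_format] E1(3) B(1,2,4,5)]) auto
    then have "dependent_minors TYPE('a) Pair E2 E1" by (rule dependent_minors_swap)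
    then show ?thesis using E1(1) B(3) by blast
  next
    fix k L assume k: "3 \<le> k" and cyc: "contains_graph G (cycle_graph k)"
      and L: "is_cycle_with_leaf L" "contains_graph H L"
    obtain A E1 a where A: "finite A" "a \<in> A" "E1 \<subseteq> edges G" "E1 \<subseteq> Pow A" "card A \<le> card E1"
      by (rule contains_cycleE[OF cyc k])
    obtain B E2 u w where B: "finite B" "u \<in> B" "w \<notin> B" "insert {u, w} E2 \<subseteq> edges H"
        "E2 \<subseteq> Pow B" "card B \<le> card E2"
      by (rule contains_leafE[OF L])
    have "dependent_minors TYPE('a) Pair E1 (insert {u, w} E2)"
      by (rule dependent_minors_leaf[OF _ A(1,2,4,5) B(1,2,3,5,6)]) simp
    then show ?thesis using A(3) B(4) by blast
  next
    fix k L assume k: "3 \<le> k" and cyc: "contains_graph H (cycle_graph k)"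
      and L: "is_cycle_with_leaf L" "contains_graph G L"
    obtain A E1 a where A: "finite A" "a \<in> A" "E1 \<subseteq> edges H" "E1 \<subseteq> Pow A" "card A \<le> card E1"
      by (rule contains_cycleE[OF cyc k])
    obtain B E2 u w where B: "finite B" "u \<in> B" "w \<notin> B" "insert {u, w} E2 \<subseteq> edges G"
        "E2 \<subseteq> Pow B" "card B \<le> card E2"
      by (rule contains_leafE[OF L])
    have "dependent_minors TYPE('a) (\<lambda>k i. (i, k)) E1 (insert {u, w} E2)"
      by (rule dependent_minors_leaf[OF _ A(1,2,4,5) B(1,2,3,5,6)]) auto
    then have "dependent_minors TYPE('a) Pair (insert {u, w} E2) E1" by (rule dependent_minors_swap)
    then show ?thesis using A(3) B(4) by blast
  qed
  then show ?thesis using analytic_spread_less[OF assms(1,4)] by blast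
qed

end
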